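(* Let $p\ge5$ be prime, set $h=\frac12\gcd(p-1,24)$, and let $k$ be an even integer. Then there exist integers $r_1,r_p$ with $f(\tau)=\eta^{r_1}(\tau)\eta^{r_p}(p\tau)\in M_k(\Gamma_1(p))$ if and only if both of the following hold: (1) $h\mid k$; (2) it is not the case that $p\neq5$, $p\equiv5\pmod{24}$, and $k=2$.
   Context: $\eta(\tau)=q^{1/24}\prod_{n\ge1}(1-q^n)$, $q=e^{2\pi i\tau}$. $M_k(\Gamma_1(p))$ is the space of holomorphic modular forms of weight $k$ on $\Gamma_1(p)$ (holomorphic on the upper half-plane and at all cusps).
   Formalization: The even integer k is assumed nonnegative; for negative k the claim as worded fails (p=5, k=-2 satisfies (1) and (2), but M_{-2}(Γ_1(5))={0} while eta quotients never vanish). *)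

theory Defs
  imports "HOL-Complex_Analysis.Complex_Analysis" "HOL-Number_Theory.Number_Theory"
begin

definition upper_half_plane :: "complex set" where
  "upper_half_plane = {\<tau>. Im \<tau> > 0}"

text \<open>The factor \<open>q\<^bsup>1/24\<^esup>\<close> means \<open>e\<^bsup>2\<pi>i\<tau>/24\<^esup>\<close>, which is not the principal 24th root of \<open>q\<close>.\<close>

definition dedekind_eta :: "complex \<Rightarrow> complex" where
  "dedekind_eta \<tau> =
     exp (2 * of_real pi * \<i> * \<tau> / 24) * (\<Prod>n. 1 - exp (2 * of_real pi * \<i> * \<tau>) ^ Suc n)"

definition SL2Z :: "(int ^ 2 ^ 2) set" where
  "SL2Z = {A. det A = 1}"

definition Gamma1 :: "nat \<Rightarrow> (int ^ 2 ^ 2) set" where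
  "Gamma1 N = {A \<in> SL2Z.
     [A $ 1 $ 1 = 1] (mod int N) \<and> [A $ 2 $ 1 = 0] (mod int N) \<and> [A $ 2 $ 2 = 1] (mod int N)}"

definition moebius_act :: "int ^ 2 ^ 2 \<Rightarrow> complex \<Rightarrow> complex" where
  "moebius_act A \<tau> =
     (of_int (A $ 1 $ 1) * \<tau> + of_int (A $ 1 $ 2)) / (of_int (A $ 2 $ 1) * \<tau> + of_int (A $ 2 $ 2))"

definition slash :: "int \<Rightarrow> (complex \<Rightarrow> complex) \<Rightarrow> int ^ 2 ^ 2 \<Rightarrow> complex \<Rightarrow> complex" where
  "slash k f A \<tau> =
     (of_int (A $ 2 $ 1) * \<tau> + of_int (A $ 2 $ 2)) powi (- k) * f (moebius_act A \<tau>)"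

text \<open>\<open>f\<close> is a function of \<open>q\<^sub>N = e\<^bsup>2\<pi>i\<tau>/N\<^esup>\<close> that extends holomorphically to \<open>q\<^sub>N = 0\<close>; equivalently,
  \<open>f\<close> has an expansion in nonnegative powers of \<open>q\<^sub>N\<close>.\<close>

definition holomorphic_at_infinity :: "nat \<Rightarrow> (complex \<Rightarrow> complex) \<Rightarrow> bool" where
  "holomorphic_at_infinity N f \<longleftrightarrow>
     (\<exists>g. g holomorphic_on ball 0 1 \<and>
          (\<forall>\<tau>\<in>upper_half_plane. f \<tau> = g (exp (2 * of_real pi * \<i> * \<tau> / of_nat N))))"

text \<open>The space \<open>M\<^sub>k(\<Gamma>\<^sub>1(N))\<close>. Modular forms are functions on the upper half-plane, so values
  elsewhere are unconstrained. Every cusp is the image of \<open>\<infinity>\<close> under some \<open>A \<in> SL\<^sub>2(\<int>)\<close>,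
  and the width of each cusp of \<open>\<Gamma>\<^sub>1(N)\<close> divides \<open>N\<close>, so \<open>q\<^sub>N\<close> can be used at all of them.\<close>

definition modular_forms_Gamma1 :: "int \<Rightarrow> nat \<Rightarrow> (complex \<Rightarrow> complex) set" where
  "modular_forms_Gamma1 k N = {f.
     f holomorphic_on upper_half_plane \<and>
     (\<forall>A\<in>Gamma1 N. \<forall>\<tau>\<in>upper_half_plane. slash k f A \<tau> = f \<tau>) \<and>
     (\<forall>A\<in>SL2Z. holomorphic_at_infinity N (slash k f A))}"

end

theory Submission
  imports Defs
begin

text \<open>
  The Jacobi theta function, normalised to have derivative 1 at the origin and written as an infinite
  product, is determined up to a constant by its quasi-periods and zeros, so by Liouville's theorem it
  transforms under all of \<open>SL\<^sub>2(\<int>)\<close> without any multiplier. The resulting Klein forms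
  \<open>K\<^sub>a(\<tau>)\<close> satisfy \<open>K\<^sub>a(A\<tau>) = (c\<tau> + d)\<^sup>-\<^sup>1 K\<^sub>a\<^sub>A(\<tau>)\<close> and change by a root of unity when
  \<open>a\<close> is shifted by an integral vector.

  The product of the three Klein forms at the points of order 2 is a constant times \<open>\<eta>\<^sup>-\<^sup>6\<close>, which
  makes \<open>\<eta>\<^sup>2\<^sup>4\<close> modular of weight 12. The product of the forms \<open>K\<^bsub>(j/p,0)\<^esub>(p\<tau>)\<close> for
  \<open>1 \<le> j \<le> (p-1)/2\<close> is a constant times \<open>\<eta>(\<tau>) / \<eta>(p\<tau>)\<^sup>p\<close>, which makes this quotient
  modular of weight \<open>-(p-1)/2\<close> on \<open>\<Gamma>\<^sub>1(p)\<close> with trivial character. Since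
  \<open>\<eta>(\<tau>)\<^sup>r \<eta>(p\<tau>)\<^sup>s\<close> is its \<open>r\<close>-th power times \<open>\<eta>(p\<tau>)\<close> to the power \<open>pr + s\<close>, it lies in
  \<open>M\<^sub>k(\<Gamma>\<^sub>1(p))\<close> exactly when \<open>r + s = 2k\<close>, \<open>24\<close> divides \<open>pr + s\<close>, and the orders \<open>(r + ps)/24\<close>
  and \<open>(pr + s)/24\<close> at the two kinds of cusps are nonnegative. The rest is arithmetic modulo 24.
\<close>

section \<open>Infinite products\<close>

text \<open>The partial products converge uniformly on a closed ball around each point by the
  Weierstrass M-test for \<open>f n - 1\<close>, and locally uniform limits of holomorphic functions
  are holomorphic.\<close>

lemma holomorphic_on_prodinf:
  fixes f :: "nat \<Rightarrow> complex \<Rightarrow> complex"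
  assumes S: "open S" and hol: "\<And>n. f n holomorphic_on S"
    and bound: "\<And>x. x \<in> S \<Longrightarrow> \<exists>d>0. \<exists>M. cball x d \<subseteq> S \<and> summable M \<and>
                   (\<forall>n. \<forall>y\<in>cball x d. norm (f n y - 1) \<le> M n)"
  shows "(\<lambda>z. \<Prod>n. f n z) holomorphic_on S"
proof (rule holomorphic_uniform_sequence[OF S, of "\<lambda>N z. \<Prod>n<N. f n z"])
  show "(\<lambda>z. \<Prod>n<N. f n z) holomorphic_on S" for N
    by (intro holomorphic_on_prod hol)
  fix x assume "x \<in> S"
  from bound[OF this] obtain d M where d: "d > 0" "cball x d \<subseteq> S" and M: "summable M"
      "\<And>n y. y \<in> cball x d \<Longrightarrow> norm (f n y - 1) \<le> M n"
    by blast
  have "uniformly_convergent_on (cball x d) (\<lambda>N z. \<Prod>n<N. f n z)"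
  proof (rule uniformly_convergent_on_prod')
    show "continuous_on (cball x d) (f n)" for n
      by (intro holomorphic_on_imp_continuous_on holomorphic_on_subset[OF hol d(2)])
    show "uniformly_convergent_on (cball x d) (\<lambda>N z. \<Sum>n<N. norm (f n z - 1))"
      by (rule Weierstrass_m_test'[OF _ M(1)]) (use M(2) in auto)
  qed auto
  then have ul: "uniform_limit (cball x d) (\<lambda>N z. \<Prod>n<N. f n z)
      (\<lambda>z. lim (\<lambda>N. \<Prod>n<N. f n z)) sequentially"
    by (simp add: uniformly_convergent_uniform_limit_iff)
  \<comment> \<open>The infinite product is defined through \<open>has_prod\<close>, which treats
    vanishing factors separately; absolute convergence identifies it with the limit of the partial
    products.\<close>
  have "lim (\<lambda>N. \<Prod>n<N. f n z) = (\<Prod>n. f n z)" if "z \<in> cball x d" for z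
  proof -
    have "summable (\<lambda>n. norm (f n z - 1))"
      by (rule summable_comparison_test[OF _ M(1)]) (use M(2) that in auto)
    then have "convergent_prod (\<lambda>n. f n z)"
      by (intro abs_convergent_prod_imp_convergent_prod summable_imp_abs_convergent_prod)
    then have "(\<lambda>N. \<Prod>n<N. f n z) \<longlonglongrightarrow> (\<Prod>n. f n z)"
      using convergent_prod_LIMSEQ by (simp add: LIMSEQ_lessThan_iff_atMost)
    then show ?thesis by (rule limI)
  qed
  then have "uniform_limit (cball x d) (\<lambda>N z. \<Prod>n<N. f n z) (\<lambda>z. \<Prod>n. f n z) sequentially"
    using ul uniform_limit_cong'[of "cball x d" "\<lambda>N z. \<Prod>n<N. f n z" _
      "\<lambda>z. lim (\<lambda>N. \<Prod>n<N. f n z)" "\<lambda>z. \<Prod>n. f n z" sequentially] by auto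
  then show "\<exists>d>0. cball x d \<subseteq> S \<and>
      uniform_limit (cball x d) (\<lambda>N z. \<Prod>n<N. f n z) (\<lambda>z. \<Prod>n. f n z) sequentially"
    using d by blast
qed

section \<open>The q-Pochhammer symbol\<close>

text \<open>The infinite symbol (x; q). The base stays an argument because products to different
  bases such as \<open>q\<close> and \<open>q ^ N\<close> are compared below.\<close>

definition qpoch :: "complex \<Rightarrow> complex \<Rightarrow> complex" where
  "qpoch x q = (\<Prod>n. 1 - x * q ^ n)"

lemma convergent_prod_qpoch:
  assumes "norm q < 1"
  shows "convergent_prod (\<lambda>n. 1 - x * q ^ n :: complex)"
proof -
  have "summable (\<lambda>n. norm x * norm q ^ n)"
    using assms by (intro summable_mult summable_geometric) auto
  then show ?thesis
    by (intro abs_convergent_prod_imp_convergent_prod summable_imp_abs_convergent_prod)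
       (simp add: norm_mult norm_power)
qed

lemma qpoch_has_prod: "norm q < 1 \<Longrightarrow> (\<lambda>n. 1 - x * q ^ n) has_prod qpoch x q"
  unfolding qpoch_def using convergent_prod_qpoch by blast

lemma qpoch_LIMSEQ:
  assumes "norm q < 1"
  shows "(\<lambda>N. \<Prod>n<N. 1 - x * q ^ n) \<longlonglongrightarrow> qpoch x q"
  unfolding qpoch_def using convergent_prod_LIMSEQ[OF convergent_prod_qpoch[OF assms]]
  by (simp add: LIMSEQ_lessThan_iff_atMost)

lemma qpoch_eq_0_iff:
  assumes "norm q < 1"
  shows "qpoch x q = 0 \<longleftrightarrow> (\<exists>n. x * q ^ n = 1)"
  using has_prod_eq_0_iff[OF qpoch_has_prod[OF assms, of x]]
  by (auto simp: image_iff)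

lemma qpoch_nonzero: "norm q < 1 \<Longrightarrow> norm x < 1 \<Longrightarrow> qpoch x q \<noteq> 0"
proof
  assume q: "norm q < 1" "norm x < 1" and "qpoch x q = 0"
  then obtain n where "x * q ^ n = 1" using qpoch_eq_0_iff by blast
  then have "norm x * norm q ^ n = 1" by (metis norm_mult norm_one norm_power)
  moreover have "norm q ^ n \<le> 1" using q by (simp add: power_le_one)
  then have "norm x * norm q ^ n \<le> norm x * 1" by (intro mult_left_mono) auto
  ultimately show False using q by simp
qed

lemma qpoch_rec:
  assumes "norm q < 1"
  shows "qpoch x q = (1 - x) * qpoch (x * q) q"
  using has_prod_unique[OF has_prod_ignore_initial_segment'[OF convergent_prod_qpoch[OF assms, of x], of 1]]
  by (simp add: qpoch_def algebra_simps)

lemma qpoch_0_left [simp]: "qpoch 0 q = 1"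
  by (simp add: qpoch_def)

lemma qpoch_mult_minus:
  assumes "norm q < 1"
  shows "qpoch x q * qpoch (- x) q = qpoch (x\<^sup>2) (q\<^sup>2)"
  unfolding qpoch_def prodinf_mult[OF convergent_prod_qpoch[OF assms] convergent_prod_qpoch[OF assms]]
proof (intro prodinf_cong)
  fix n
  have "(q\<^sup>2) ^ n = (q ^ n)\<^sup>2" by (metis power_mult mult.commute)
  then show "(1 - x * q ^ n) * (1 - - x * q ^ n) = 1 - x\<^sup>2 * (q\<^sup>2) ^ n"
    by (simp only: power2_eq_square) (simp add: algebra_simps)
qed

text \<open>The exponents are sorted by residue modulo \<open>N\<close>. The regrouping takes place
  in the finite products with \<open>M * N\<close> factors; both sides then pass to the limit in
  \<open>M\<close>.\<close>

lemma qpoch_split_residues: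
  assumes q: "norm q < 1" and N: "N > 0"
  shows "(\<Prod>j<N. qpoch (x * q ^ j) (q ^ N)) = qpoch x q"
proof -
  have qN: "norm (q ^ N) < 1"
    using q N by (simp add: norm_power power_less_one_iff)
  have lim: "(\<lambda>M. \<Prod>j<N. \<Prod>n<M. 1 - x * q ^ j * (q ^ N) ^ n)
          \<longlonglongrightarrow> (\<Prod>j<N. qpoch (x * q ^ j) (q ^ N))"
    by (intro tendsto_prod qpoch_LIMSEQ qN)
  have "(\<lambda>M. \<Prod>n<M * N. 1 - x * q ^ n) \<longlonglongrightarrow> qpoch x q"
    using LIMSEQ_subseq_LIMSEQ[OF qpoch_LIMSEQ[OF q, of x], of "\<lambda>M. M * N"] N
    by (simp add: strict_mono_def o_def)
  also have "(\<lambda>M. \<Prod>n<M * N. 1 - x * q ^ n) = (\<lambda>M. \<Prod>j<N. \<Prod>n<M. 1 - x * q ^ j * (q ^ N) ^ n)"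
  proof
    fix M
    have "(\<Prod>n<M * N. 1 - x * q ^ n) = (\<Prod>m<M. \<Prod>n\<in>{m * N..<m * N + N}. 1 - x * q ^ n)"
      by (rule prod.nat_group[symmetric])
    also have "\<dots> = (\<Prod>m<M. \<Prod>j<N. 1 - x * q ^ j * (q ^ N) ^ m)"
    proof (rule prod.cong[OF refl])
      fix m
      have "(\<Prod>n\<in>{m * N..<m * N + N}. 1 - x * q ^ n) = (\<Prod>j\<in>{0..<N}. 1 - x * q ^ (j + m * N))"
        using prod.shift_bounds_nat_ivl[of "\<lambda>n. 1 - x * q ^ n" 0 "m * N" N] by (simp add: add.commute)
      then show "(\<Prod>n\<in>{m * N..<m * N + N}. 1 - x * q ^ n) = (\<Prod>j<N. 1 - x * q ^ j * (q ^ N) ^ m)"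
        by (simp add: power_add power_mult[symmetric] mult_ac atLeast0LessThan)
    qed
    also have "\<dots> = (\<Prod>j<N. \<Prod>n<M. 1 - x * q ^ j * (q ^ N) ^ n)"
      by (rule prod.swap)
    finally show "(\<Prod>n<M * N. 1 - x * q ^ n) = (\<Prod>j<N. \<Prod>n<M. 1 - x * q ^ j * (q ^ N) ^ n)" .
  qed
  finally have "(\<lambda>M. \<Prod>j<N. \<Prod>n<M. 1 - x * q ^ j * (q ^ N) ^ n) \<longlonglongrightarrow> qpoch x q" .
  with lim show ?thesis by (rule LIMSEQ_unique)
qed

lemma holomorphic_on_qpoch [holomorphic_intros]:
  assumes S: "open S" and a: "a holomorphic_on S" and b: "b holomorphic_on S"
    and lt: "\<And>z. z \<in> S \<Longrightarrow> norm (b z) < 1"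
  shows "(\<lambda>z. qpoch (a z) (b z)) holomorphic_on S"
  unfolding qpoch_def
proof (rule holomorphic_on_prodinf[OF S])
  show "(\<lambda>z. 1 - a z * b z ^ n) holomorphic_on S" for n
    by (intro holomorphic_intros a b)
  fix x assume "x \<in> S"
  then obtain d where d: "d > 0" "cball x d \<subseteq> S" using S open_contains_cball by blast
  have ca: "continuous_on (cball x d) (\<lambda>z. norm (a z))" and cb: "continuous_on (cball x d) (\<lambda>z. norm (b z))"
    by (intro continuous_on_norm holomorphic_on_imp_continuous_on
              holomorphic_on_subset[OF a d(2)] holomorphic_on_subset[OF b d(2)])+
  have ne: "cball x d \<noteq> {}" using d by simp
  \<comment> \<open>The maxima of \<open>a\<close> and \<open>b\<close> on the compact ball give a
    geometric majorant, whose ratio \<open>norm (b v)\<close> is less than 1.\<close>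
  obtain u where u: "u \<in> cball x d" "\<And>y. y \<in> cball x d \<Longrightarrow> norm (a y) \<le> norm (a u)"
    using continuous_attains_sup[OF compact_cball ne ca] by blast
  obtain v where v: "v \<in> cball x d" "\<And>y. y \<in> cball x d \<Longrightarrow> norm (b y) \<le> norm (b v)"
    using continuous_attains_sup[OF compact_cball ne cb] by blast
  have "summable (\<lambda>n. norm (a u) * norm (b v) ^ n)"
    using lt v(1) d(2) by (intro summable_mult summable_geometric) auto
  moreover have "norm (1 - a y * b y ^ n - 1) \<le> norm (a u) * norm (b v) ^ n" if "y \<in> cball x d" for n y
    using u(2)[OF that] v(2)[OF that]
    by (auto simp: norm_mult norm_power intro!: mult_mono power_mono)
  ultimately show "\<exists>d>0. \<exists>M. cball x d \<subseteq> S \<and> summable M \<and>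
      (\<forall>n. \<forall>y\<in>cball x d. norm (1 - a y * b y ^ n - 1) \<le> M n)"
    using d by (intro exI[of _ d] conjI exI[of _ "\<lambda>n. norm (a u) * norm (b v) ^ n"]) simp_all
qed

section \<open>The theta function\<close>

text \<open>Period 2 instead of 1 lets signs and half-integral powers of q be written as values of
  this function: \<open>expi 1 = -1\<close> and q is \<open>expi (2 * \<tau>)\<close>.\<close>

definition expi :: "complex \<Rightarrow> complex" where
  "expi x = exp (of_real pi * \<i> * x)"

lemma expi_add: "expi (x + y) = expi x * expi y"
  by (simp add: expi_def exp_add ring_distribs)

lemma expi_diff: "expi (x - y) = expi x / expi y"
  by (simp add: expi_def exp_diff ring_distribs)

lemma expi_minus: "expi (- x) = inverse (expi x)"
  by (simp add: expi_def exp_minus)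

lemma expi_nonzero [simp]: "expi x \<noteq> 0"
  by (simp add: expi_def)

lemma expi_0 [simp]: "expi 0 = 1"
  by (simp add: expi_def)

lemma expi_1 [simp]: "expi 1 = -1"
  by (simp add: expi_def)

lemma expi_mult_of_nat: "expi (of_nat n * x) = expi x ^ n"
  by (simp add: expi_def mult.left_commute flip: exp_of_nat_mult)

lemma expi_mult_of_int: "expi (of_int n * x) = expi x powi n"
  by (simp add: expi_def exp_power_int mult.left_commute)

lemma expi_mult_cancel: "expi x * u = expi y * v \<Longrightarrow> u = expi (y - x) * v"
  by (simp add: expi_diff field_simps)

lemma expi_eq_1_iff: "expi x = 1 \<longleftrightarrow> (\<exists>n::int. x = 2 * of_int n)"
  unfolding expi_def exp_eq_1
proof safe
  fix n :: int
  assume "Re (of_real pi * \<i> * x) = 0" and "Im (of_real pi * \<i> * x) = of_int (2 * n) * pi"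
  then show "\<exists>n. x = 2 * of_int n"
    by (intro exI[of _ n]) (auto simp: complex_eq_iff)
qed auto

lemma expi_even_int [simp]: "expi (2 * of_int n) = 1"
  by (auto simp: expi_eq_1_iff)

lemma expi_odd_int: "odd n \<Longrightarrow> expi (of_int n) = -1"
proof -
  assume "odd n"
  then obtain k where "n = 2 * k + 1" by (auto elim: oddE)
  then have "expi (of_int n) = expi (2 * of_int k) * expi 1" by (simp add: expi_add)
  then show ?thesis by simp
qed

lemma norm_expi: "norm (expi x) = exp (- pi * Im x)"
  by (simp add: expi_def)

lemma norm_expi_less_1: "Im x > 0 \<Longrightarrow> norm (expi x) < 1"
  by (simp add: norm_expi)

lemma holomorphic_on_expi [holomorphic_intros]:
  "f holomorphic_on S \<Longrightarrow> (\<lambda>z. expi (f z)) holomorphic_on S"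
  unfolding expi_def by (intro holomorphic_intros)

section \<open>Doubly periodic functions and Liouville's theorem\<close>

text \<open>The codomain is arbitrary so that the lemma also covers predicates:
  \<open>H z = 0\<close> is periodic even when \<open>H\<close> is only quasi-periodic.\<close>

lemma periodic_lattice:
  fixes g :: "complex \<Rightarrow> 'a" and m n :: int
  assumes one: "\<And>z. g (z + 1) = g z" and t: "\<And>z. g (z + \<tau>) = g z"
  shows "g (z + of_int m * \<tau> + of_int n) = g z"
proof -
  have t': "g (z - \<tau>) = g z" for z using t[of "z - \<tau>"] by simp
  have one': "g (z - 1) = g z" for z using one[of "z - 1"] by simp
  have "g (z + of_int n) = g z" for z
  proof (induction n rule: int_induct[where k = 0])
    case (step1 i)
    then show ?case using one[of "z + of_int i"] by (simp add: add.assoc)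
  next
    case (step2 i)
    then show ?case using one'[of "z + of_int i"] by (simp add: algebra_simps)
  qed simp
  moreover have "g (z + of_int m * \<tau>) = g z" for z
  proof (induction m rule: int_induct[where k = 0])
    case (step1 i)
    then show ?case using t[of "z + of_int i * \<tau>"] by (simp add: algebra_simps)
  next
    case (step2 i)
    then show ?case using t'[of "z + of_int i * \<tau>"] by (simp add: algebra_simps)
  qed simp
  ultimately show ?thesis by simp
qed

text \<open>Reducing the coordinates of \<open>z\<close> in the basis \<open>\<tau>\<close>, 1 to
  their fractional parts shows that all values are taken on the compact fundamental parallelogram,
  so Liouville's theorem applies.\<close>

lemma doubly_periodic_entire_constant:
  assumes \<tau>: "Im \<tau> > 0" and hol: "F holomorphic_on UNIV"
    and per: "\<And>z. F (z + 1) = F z" "\<And>z. F (z + \<tau>) = F z"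
  shows "F z = F 0"
proof -
  define K where "K = (\<lambda>(s, t). of_real s * \<tau> + of_real t) ` ({0..1::real} \<times> {0..1::real})"
  have "compact K"
    unfolding K_def case_prod_unfold
    by (intro compact_continuous_image compact_Times continuous_intros compact_Icc)
  then have "bounded (F ` K)"
    using holomorphic_on_imp_continuous_on[OF hol]
    by (intro compact_imp_bounded compact_continuous_image) (auto intro: continuous_on_subset)
  moreover have "range F \<subseteq> F ` K"
  proof safe
    fix z
    define s where "s = Im z / Im \<tau>"
    define t where "t = Re z - s * Re \<tau>"
    have z: "z = of_real s * \<tau> + of_real t"
      using \<tau> by (simp add: complex_eq_iff s_def t_def)
    have "F z = F (z + of_int (- \<lfloor>s\<rfloor>) * \<tau> + of_int (- \<lfloor>t\<rfloor>))"
      by (rule periodic_lattice[OF per, symmetric])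
    also have "z + of_int (- \<lfloor>s\<rfloor>) * \<tau> + of_int (- \<lfloor>t\<rfloor>) = of_real (frac s) * \<tau> + of_real (frac t)"
      by (subst z) (simp add: frac_def algebra_simps)
    finally have "F z = F (of_real (frac s) * \<tau> + of_real (frac t))" .
    moreover have "of_real (frac s) * \<tau> + of_real (frac t) \<in> K"
      unfolding K_def by (rule image_eqI[of _ _ "(frac s, frac t)"])
        (auto simp: less_imp_le[OF frac_lt_1])
    ultimately show "F z \<in> F ` K" by blast
  qed
  ultimately have "bounded (range F)" using bounded_subset by blast
  then have "F constant_on UNIV" using Liouville_theorem[OF hol] by blast
  then show ?thesis unfolding constant_on_def by auto
qed

text \<open>Since \<open>x / 0 = 0\<close>, the quotient \<open>(N - e / d * D) / D\<close> is already continuous at the lattice points,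
  so it is entire without any redefinition.\<close>

lemma quasi_periodic_proportional:
  assumes \<tau>: "Im \<tau> > 0"
    and N: "N holomorphic_on UNIV" and D: "D holomorphic_on UNIV"
    and N1: "\<And>z. N (z + 1) = \<mu> z * N z" and Nt: "\<And>z. N (z + \<tau>) = \<nu> z * N z"
    and D1: "\<And>z. D (z + 1) = \<mu> z * D z" and Dt: "\<And>z. D (z + \<tau>) = \<nu> z * D z"
    and nz: "\<And>z. \<mu> z \<noteq> 0" "\<And>z. \<nu> z \<noteq> 0"
    and zeros: "\<And>z. D z = 0 \<Longrightarrow> \<exists>m n :: int. z = of_int m * \<tau> + of_int n"
    and 0: "N 0 = 0" "D 0 = 0"
    and N': "(N has_field_derivative e) (at 0)" and D': "(D has_field_derivative d) (at 0)"
    and d: "d \<noteq> 0"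
  shows "N z = e / d * D z"
proof -
  \<comment> \<open>The multiple \<open>e / d\<close> cancels the first-order terms at 0, so
    \<open>H\<close> vanishes there to order at least two while \<open>D\<close> has a simple zero;
    hence \<open>H z / D z\<close> tends to 0.\<close>
  define H where "H = (\<lambda>z. N z - e / d * D z)"
  define F where "F = (\<lambda>z. H z / D z)"
  have H1: "H (z + 1) = \<mu> z * H z" and Ht: "H (z + \<tau>) = \<nu> z * H z" for z
    unfolding H_def N1 D1 Nt Dt by (simp_all add: algebra_simps)
  have per: "F (z + 1) = F z" "F (z + \<tau>) = F z" for z
    by (simp_all add: F_def H1 Ht D1 Dt nz)
  have Hhol: "H holomorphic_on UNIV" unfolding H_def by (intro holomorphic_intros N D)
  have H': "(H has_field_derivative 0) (at 0)"
    unfolding H_def using DERIV_diff[OF N' DERIV_cmult[OF D', of "e / d"]] d by simp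
  have F0: "F 0 = 0" by (simp add: F_def 0)
  have dlim: "((\<lambda>z. D z / z) \<longlongrightarrow> d) (at 0)"
    using D' by (simp add: DERIV_def 0)
  have hlim: "((\<lambda>z. H z / z) \<longlongrightarrow> 0) (at 0)"
    using H' by (simp add: DERIV_def H_def 0)
  have "((\<lambda>z. (H z / z) / (D z / z)) \<longlongrightarrow> 0 / d) (at 0)"
    by (intro tendsto_divide hlim dlim d)
  then have "((\<lambda>z. (H z / z) / (D z / z)) \<longlongrightarrow> 0) (at 0)" by simp
  then have Flim: "(F \<longlongrightarrow> 0) (at 0)"
    by (rule Lim_transform_eventually) (auto simp: eventually_at F_def intro!: exI[of _ 1])
  have nonzero_diff: "F field_differentiable at z" if "D z \<noteq> 0" for z
    unfolding F_def using that Hhol D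
    by (intro field_differentiable_divide) (auto simp: holomorphic_on_def)
  have "eventually (\<lambda>z. D z / z \<noteq> 0) (at 0)"
    using dlim d by (rule tendsto_imp_eventually_ne)
  then obtain r where r: "r > 0" and r': "\<And>z. z \<noteq> 0 \<Longrightarrow> dist z 0 < r \<Longrightarrow> D z / z \<noteq> 0"
    unfolding eventually_at by blast
  have Dnz: "D z \<noteq> 0" if "z \<noteq> 0" "dist z 0 < r" for z
    using r'[OF that] by auto
  have "F holomorphic_on ball 0 r"
  proof (rule no_isolated_singularity[where K = "{0}"])
    show "F holomorphic_on (ball 0 r - {0})"
      unfolding holomorphic_on_def
    proof
      fix z :: complex assume "z \<in> ball 0 r - {0}"
      then have "D z \<noteq> 0" by (intro Dnz) (simp_all add: dist_commute)
      then show "F field_differentiable at z within ball 0 r - {0}"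
        by (rule field_differentiable_at_within[OF nonzero_diff])
    qed
    have "isCont F z" if "z \<in> ball 0 r" for z
    proof (cases "z = 0")
      case True
      then show ?thesis using Flim F0 by (simp add: isCont_def)
    next
      case False
      then have "D z \<noteq> 0" using that by (intro Dnz) (simp_all add: dist_commute)
      then show ?thesis by (intro field_differentiable_imp_continuous_at nonzero_diff)
    qed
    then show "continuous_on (ball 0 r) F"
      by (simp add: continuous_at_imp_continuous_on)
  qed auto
  then have diff0: "F field_differentiable at 0"
    using r by (simp add: holomorphic_on_open field_differentiable_def)
  have "F field_differentiable at z" for z
  proof (cases "D z = 0")
    case False
    then show ?thesis by (rule nonzero_diff)
  next
    case True
    then obtain m n where z: "z = of_int m * \<tau> + of_int n" using zeros by blast
    \<comment> \<open>Periodicity transports differentiability from 0 to every other zero of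
      \<open>D\<close>.\<close>
    have shift: "F w = F (w - z)" for w
      using periodic_lattice[OF per, of "w - z" m n] by (simp add: z algebra_simps)
    have "(F \<circ> (\<lambda>w. w - z)) field_differentiable at z"
      using diff0 by (intro field_differentiable_compose derivative_intros) auto
    moreover have "F \<circ> (\<lambda>w. w - z) = F" by (simp add: fun_eq_iff flip: shift)
    ultimately show ?thesis by simp
  qed
  then have "F holomorphic_on UNIV"
    by (simp add: holomorphic_on_def)
  then have "F z = 0" for z
    using doubly_periodic_entire_constant[OF \<tau> _ per] F0 by metis
  \<comment> \<open>The vanishing of \<open>F\<close> gives that of \<open>H\<close> only off the
    zeros of \<open>D\<close>. At those lattice points it is carried over from
    \<open>H 0 = 0\<close> by the quasi-periods.\<close>
  then have *: "D z \<noteq> 0 \<Longrightarrow> H z = 0" by (metis F_def divide_eq_0_iff)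
  have "H z = 0"
  proof (cases "D z = 0")
    case True
    then obtain m n where z: "z = of_int m * \<tau> + of_int n" using zeros by blast
    have "(H (0 + of_int m * \<tau> + of_int n) = 0) = (H 0 = 0)"
      by (rule periodic_lattice) (simp_all add: H1 Ht nz)
    then show ?thesis using z by (simp add: H_def 0)
  qed (rule *)
  then show ?thesis by (simp add: H_def)
qed

section \<open>The theta function and its behaviour under the modular group\<close>

text \<open>Jacobi's theta_1 divided by its derivative at 0: sin(pi z)/pi times the product over n
  \<ge> 1 of (1 - x q^n)(1 - q^n/x)/(1 - q^n)^2, where x is \<open>expi (2 * z)\<close>.\<close>

definition theta :: "complex \<Rightarrow> complex \<Rightarrow> complex" where
  "theta z \<tau> = - expi (- z) * qpoch (expi (2 * z)) (expi (2 * \<tau>)) *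
     qpoch (expi (2 * \<tau> - 2 * z)) (expi (2 * \<tau>)) /
     (2 * of_real pi * \<i> * qpoch (expi (2 * \<tau>)) (expi (2 * \<tau>)) ^ 2)"

lemma theta_0 [simp]: "Im \<tau> > 0 \<Longrightarrow> theta 0 \<tau> = 0"
  using qpoch_rec[of "expi (2 * \<tau>)" 1] by (simp add: theta_def norm_expi_less_1)

lemma theta_add_1: "theta (z + 1) \<tau> = expi 1 * theta z \<tau>"
proof -
  have "expi (2 * (z + 1)) = expi (2 * z)" "expi (2 * \<tau> - 2 * (z + 1)) = expi (2 * \<tau> - 2 * z)"
    using expi_even_int[of 1] by (simp_all add: ring_distribs expi_add expi_diff)
  then show ?thesis unfolding theta_def by (simp add: expi_diff)
qed

text \<open>Translation by \<open>\<tau>\<close> multiplies \<open>x\<close> by \<open>q\<close>.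
  One product loses the factor \<open>1 - x\<close>, the other gains \<open>1 - 1 / x\<close>, and
  the quotient of these factors is -1/x.\<close>

lemma theta_add_tau:
  assumes "Im \<tau> > 0"
  shows "theta (z + \<tau>) \<tau> = expi (1 - 2 * z - \<tau>) * theta z \<tau>"
proof -
  define q where "q = expi (2 * \<tau>)"
  define x where "x = expi (2 * z)"
  have q: "norm q < 1" unfolding q_def using assms by (intro norm_expi_less_1) simp
  have x: "x \<noteq> 0" by (simp add: x_def)
  have 1: "qpoch x q = (1 - x) * qpoch (x * q) q" by (rule qpoch_rec[OF q])
  have 2: "qpoch (1 / x) q = (1 - 1 / x) * qpoch (q / x) q"
    using qpoch_rec[OF q, of "1 / x"] by simp
  have e: "expi (2 * (z + \<tau>)) = x * q" "expi (2 * \<tau> - 2 * (z + \<tau>)) = 1 / x"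
    "expi (2 * \<tau> - 2 * z) = q / x" "expi (- (z + \<tau>)) = expi (- z) * expi (- \<tau>)"
    "expi (1 - 2 * z - \<tau>) = - expi (- \<tau>) / x"
    by (simp_all add: x_def q_def ring_distribs expi_add expi_diff expi_minus field_simps)
  have key: "qpoch (x * q) q * qpoch (1 / x) q = - (1 / x) * (qpoch x q * qpoch (q / x) q)"
    unfolding 1 2 using x by (simp add: field_simps)
  have "theta (z + \<tau>) \<tau> = - expi (- z) * expi (- \<tau>) * (qpoch (x * q) q * qpoch (1 / x) q) /
      (2 * of_real pi * \<i> * qpoch q q ^ 2)"
    unfolding theta_def e q_def[symmetric] by simp
  also have "\<dots> = - expi (- \<tau>) / x * (- expi (- z) * qpoch x q * qpoch (q / x) q /
      (2 * of_real pi * \<i> * qpoch q q ^ 2))"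
    unfolding key by simp
  also have "\<dots> = expi (1 - 2 * z - \<tau>) * theta z \<tau>"
    unfolding theta_def e q_def[symmetric] x_def[symmetric] by simp
  finally show ?thesis .
qed

text \<open>The exponent is quadratic in \<open>m\<close> because each further step by
  \<open>\<tau>\<close> contributes its factor at an already shifted point.\<close>

lemma theta_add_lattice:
  fixes m n :: int
  assumes "Im \<tau> > 0"
  shows "theta (z + of_int m * \<tau> + of_int n) \<tau> =
    expi (of_int m + of_int n - 2 * of_int m * z - of_int m ^ 2 * \<tau>) * theta z \<tau>"
proof -
  have n: "theta (z + of_int n) \<tau> = expi (of_int n) * theta z \<tau>" for z
  proof (induction n rule: int_induct[where k = 0])
    case (step1 i)
    then show ?case using theta_add_1[of "z + of_int i" \<tau>] by (simp add: add.assoc expi_add)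
  next
    case (step2 i)
    have "theta (z + of_int i) \<tau> = - theta (z + of_int (i - 1)) \<tau>"
      using theta_add_1[of "z + of_int (i - 1)" \<tau>] by simp
    then show ?case using step2 by (simp add: expi_diff)
  qed simp
  have m: "theta (z + of_int m * \<tau>) \<tau> = expi (of_int m - 2 * of_int m * z - of_int m ^ 2 * \<tau>) * theta z \<tau>"
  proof (induction m rule: int_induct[where k = 0])
    case (step1 i)
    have "theta (z + of_int (i + 1) * \<tau>) \<tau> = theta (z + of_int i * \<tau> + \<tau>) \<tau>"
      by (simp add: algebra_simps)
    also have "\<dots> = expi (1 - 2 * (z + of_int i * \<tau>) - \<tau>) *
        (expi (of_int i - 2 * of_int i * z - of_int i ^ 2 * \<tau>) * theta z \<tau>)"
      by (simp only: theta_add_tau[OF assms] step1)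
    also have "\<dots> = expi ((1 - 2 * (z + of_int i * \<tau>) - \<tau>) + (of_int i - 2 * of_int i * z - of_int i ^ 2 * \<tau>)) * theta z \<tau>"
      by (simp only: expi_add mult.assoc)
    also have "(1 - 2 * (z + of_int i * \<tau>) - \<tau>) + (of_int i - 2 * of_int i * z - of_int i ^ 2 * \<tau>)
        = of_int (i + 1) - 2 * of_int (i + 1) * z - of_int (i + 1) ^ 2 * \<tau>"
      by (simp add: algebra_simps power2_eq_square)
    finally show ?case .
  next
    case (step2 i)
    \<comment> \<open>Downward step: the translation rule at \<open>w\<close> is solved for
      \<open>theta w \<tau>\<close>.\<close>
    define w where "w = z + of_int (i - 1) * \<tau>"
    have "theta (w + \<tau>) \<tau> = theta (z + of_int i * \<tau>) \<tau>"
      by (simp add: algebra_simps w_def)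
    then have "expi (1 - 2 * w - \<tau>) * theta w \<tau> =
        expi (of_int i - 2 * of_int i * z - of_int i ^ 2 * \<tau>) * theta z \<tau>"
      by (simp only: theta_add_tau[OF assms] step2)
    then have "theta w \<tau> = expi (of_int i - 2 * of_int i * z - of_int i ^ 2 * \<tau> - (1 - 2 * w - \<tau>)) * theta z \<tau>"
      by (rule expi_mult_cancel)
    also have "of_int i - 2 * of_int i * z - of_int i ^ 2 * \<tau> - (1 - 2 * w - \<tau>)
        = of_int (i - 1) - 2 * of_int (i - 1) * z - of_int (i - 1) ^ 2 * \<tau>"
      by (simp add: algebra_simps power2_eq_square w_def)
    finally show ?case by (simp only: w_def)
  qed simp
  show ?thesis unfolding n m by (simp add: mult.assoc[symmetric] flip: expi_add) (simp add: algebra_simps)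
qed

text \<open>A vanishing product has a vanishing factor; the first product yields zeros with
  \<open>m\<close> \<le> 0, the second those with \<open>m\<close> > 0.\<close>

lemma theta_eq_0D:
  assumes "Im \<tau> > 0" "theta z \<tau> = 0"
  shows "\<exists>m n :: int. z = of_int m * \<tau> + of_int n"
proof -
  have q: "norm (expi (2 * \<tau>)) < 1" using assms by (intro norm_expi_less_1) simp
  have pow: "x * expi (2 * \<tau>) ^ n = 1 \<longleftrightarrow> (\<exists>k::int. y + 2 * of_nat n * \<tau> = 2 * of_int k)" if "x = expi y" for x y n
    unfolding that expi_eq_1_iff[symmetric] expi_add by (simp add: expi_mult_of_nat[symmetric] mult_ac)
  have "qpoch (expi (2 * z)) (expi (2 * \<tau>)) = 0 \<or> qpoch (expi (2 * \<tau> - 2 * z)) (expi (2 * \<tau>)) = 0"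
    using assms qpoch_nonzero[OF q q] by (simp add: theta_def)
  then consider n k where "2 * z + 2 * of_nat n * \<tau> = 2 * of_int k"
    | n k where "2 * \<tau> - 2 * z + 2 * of_nat n * \<tau> = 2 * of_int k"
    unfolding qpoch_eq_0_iff[OF q] pow[OF refl] by blast
  then show ?thesis
  proof cases
    case 1
    then have "2 * z = 2 * (of_int (- int n) * \<tau> + of_int k)" by (simp add: algebra_simps)
    then have "z = of_int (- int n) * \<tau> + of_int k" by (subst (asm) mult_left_cancel) simp_all
    then show ?thesis by blast
  next
    case 2
    then have "2 * z = 2 * (of_int (int n + 1) * \<tau> + of_int (- k))" by (simp add: algebra_simps)
    then have "z = of_int (int n + 1) * \<tau> + of_int (- k)" by (subst (asm) mult_left_cancel) simp_all
    then show ?thesis by blast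
  qed
qed

lemma holomorphic_on_theta [holomorphic_intros]:
  assumes "Im \<tau> > 0" and "open S" and "f holomorphic_on S"
  shows "(\<lambda>z. theta (f z) \<tau>) holomorphic_on S"
proof -
  have q: "norm (expi (2 * \<tau>)) < 1" using assms by (intro norm_expi_less_1) simp
  show ?thesis unfolding theta_def
    using qpoch_nonzero[OF q q] q by (intro holomorphic_intros assms) auto
qed

text \<open>The factor \<open>1 - expi (2 * z)\<close> carries the simple zero, with derivative -2
  pi i; the cofactor \<open>H\<close> has the value -1/(2 pi i) at 0.\<close>

lemma has_field_derivative_theta_0:
  assumes "Im \<tau> > 0"
  shows "((\<lambda>z. theta z \<tau>) has_field_derivative 1) (at 0)"
proof -
  define q where "q = expi (2 * \<tau>)"
  have q: "norm q < 1" unfolding q_def using assms by (intro norm_expi_less_1) simp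
  define H where "H = (\<lambda>z. - expi (- z) * qpoch (expi (2 * z) * q) q * qpoch (expi (2 * \<tau> - 2 * z)) q /
     (2 * of_real pi * \<i> * qpoch q q ^ 2))"
  have th: "theta z \<tau> = (1 - expi (2 * z)) * H z" for z
    unfolding theta_def H_def q_def[symmetric] qpoch_rec[OF q, of "expi (2 * z)"] by simp
  have "H holomorphic_on UNIV"
    unfolding H_def using q qpoch_nonzero[OF q q] by (intro holomorphic_intros) auto
  then obtain h where h: "(H has_field_derivative h) (at 0)"
    unfolding holomorphic_on_def field_differentiable_def by auto
  have H0: "H 0 = - 1 / (2 * of_real pi * \<i>)"
    using qpoch_nonzero[OF q q] by (simp add: H_def q_def[symmetric] power2_eq_square)
  have "((\<lambda>z. 1 - expi (2 * z)) has_field_derivative - (2 * of_real pi * \<i>)) (at 0)"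
    unfolding expi_def by (auto intro!: derivative_eq_intros)
  from DERIV_mult[OF this h] show ?thesis unfolding th by (simp add: H0)
qed

text \<open>Each expression is even only if both of its entries are even, which would make the
  determinant even.\<close>

lemma odd_det_entries:
  fixes a b c d :: int
  assumes "a * d - b * c = 1"
  shows "odd (a - c - a * c)" "odd (d - b - b * d)"
proof -
  have "odd (a * d - b * c)" using assms by simp
  then show "odd (a - c - a * c)" "odd (d - b - b * d)" by (auto simp: even_diff)
qed

text \<open>The Gaussian factor in \<open>N\<close> cancels the quadratic exponents, so
  \<open>N\<close> gets the quasi-periods of \<open>theta z \<tau>\<close>. The two functions are
  then proportional, and their derivatives at 0 give the constant 1/J, with no root of
  unity.\<close>

lemma theta_moebius:
  fixes a b c d :: int
  assumes det: "a * d - b * c = 1" and \<tau>: "Im \<tau> > 0"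
    and J: "J = of_int c * \<tau> + of_int d" "J \<noteq> 0"
    and t: "t = (of_int a * \<tau> + of_int b) / J" "Im t > 0"
  shows "theta (z / J) t = expi (of_int c * z ^ 2 / J) / J * theta z \<tau>"
proof -
  have det': "of_int a * of_int d - of_int b * of_int c = (1 :: complex)"
    using det by (metis of_int_1 of_int_diff of_int_mult)
  have tJ: "t * J = of_int a * \<tau> + of_int b" using J t by simp
  \<comment> \<open>Translating \<open>z\<close> by 1 or \<open>\<tau>\<close> translates
    \<open>z / J\<close> by the vectors \<open>a - c * t\<close> and \<open>d * t - b\<close> of the
    lattice spanned by \<open>t\<close> and 1.\<close>
  have "J * (- of_int c * t + of_int a) = of_int a * J - of_int c * (t * J)"
    by (simp add: algebra_simps)
  also have "\<dots> = 1" unfolding tJ unfolding J(1) using det' by (simp add: algebra_simps)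
  finally have i1: "1 / J = - of_int c * t + of_int a"
    using J(2) by (simp add: field_simps)
  have "J * (of_int d * t - of_int b) = of_int d * (t * J) - of_int b * J"
    by (simp add: algebra_simps)
  also have "\<dots> = \<tau> * (of_int a * of_int d - of_int b * of_int c)"
    unfolding tJ unfolding J(1) by (simp add: algebra_simps)
  finally have i2: "\<tau> / J = of_int d * t - of_int b"
    unfolding det' using J(2) by (simp add: field_simps)
  define N where "N = (\<lambda>z. expi (- of_int c * z ^ 2 / J) * theta (z / J) t)"
  have N1: "N (z + 1) = expi 1 * N z" for z
  proof -
    have z: "(z + 1) / J = z / J + of_int (- c) * t + of_int a"
      using i1 by (simp add: add_divide_distrib)
    have "- of_int c * (z + 1) ^ 2 / J = - of_int c * z ^ 2 / J - 2 * of_int c * (z / J) - of_int c * (1 / J)"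
      using J(2) by (simp add: field_simps power2_eq_square)
    also have "of_int c * (1 / J) = - (of_int c ^ 2 * t) + of_int (a * c)"
      unfolding i1 by (simp add: algebra_simps power2_eq_square)
    finally have e: "- of_int c * (z + 1) ^ 2 / J +
        (of_int (- c) + of_int a - 2 * of_int (- c) * (z / J) - of_int (- c) ^ 2 * t)
        = of_int (a - c - a * c) + - of_int c * z ^ 2 / J"
      by (simp add: algebra_simps)
    have "N (z + 1) = expi (- of_int c * (z + 1) ^ 2 / J +
        (of_int (- c) + of_int a - 2 * of_int (- c) * (z / J) - of_int (- c) ^ 2 * t)) * theta (z / J) t"
      unfolding N_def z theta_add_lattice[OF t(2)] by (simp only: expi_add mult.assoc)
    also have "\<dots> = expi 1 * N z"
      unfolding e N_def expi_add expi_odd_int[OF odd_det_entries(1)[OF det]] by simp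
    finally show ?thesis .
  qed
  have Nt: "N (z + \<tau>) = expi (1 - 2 * z - \<tau>) * N z" for z
  proof -
    have z: "(z + \<tau>) / J = z / J + of_int d * t + of_int (- b)"
      using i2 by (simp add: add_divide_distrib)
    \<comment> \<open>The terms of the exponent free of \<open>z\<close>: the determinant reduces
      them to \<open>\<tau>\<close> plus the integer \<open>b * d\<close>, which only affects the
      sign.\<close>
    have "J * (of_int d ^ 2 * t + of_int c * \<tau> * (\<tau> / J)) = of_int d ^ 2 * (t * J) + of_int c * \<tau> ^ 2"
      using J(2) by (simp add: algebra_simps power2_eq_square)
    also have "\<dots> = (of_int a * of_int d - of_int b * of_int c) * of_int d * \<tau> + of_int b * of_int d * J + of_int c * \<tau> ^ 2"
      unfolding tJ unfolding J(1) by (simp add: algebra_simps power2_eq_square)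
    also have "\<dots> = J * (\<tau> + of_int (b * d))"
      unfolding det' J(1) by (simp add: algebra_simps power2_eq_square)
    finally have sq: "of_int d ^ 2 * t + of_int c * \<tau> * (\<tau> / J) = \<tau> + of_int (b * d)"
      using J(2) by simp
    have "(2 * of_int d * z + 2 * of_int c * z * \<tau>) / J = 2 * z"
      using J by (simp add: field_simps)
    then have lin: "2 * of_int d * (z / J) + 2 * of_int c * z * (\<tau> / J) = 2 * z"
      by (simp add: add_divide_distrib)
    have "- of_int c * (z + \<tau>) ^ 2 / J + (of_int d + of_int (- b) - 2 * of_int d * (z / J) - of_int d ^ 2 * t)
       = of_int d - of_int b - (2 * of_int d * (z / J) + 2 * of_int c * z * (\<tau> / J))
          - (of_int d ^ 2 * t + of_int c * \<tau> * (\<tau> / J)) + - of_int c * z ^ 2 / J"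
      using J(2) by (simp add: field_simps power2_eq_square)
    also have "\<dots> = of_int (d - b - b * d) + (- 2 * z - \<tau>) + - of_int c * z ^ 2 / J"
      unfolding sq lin by simp
    finally have e: "- of_int c * (z + \<tau>) ^ 2 / J + (of_int d + of_int (- b) - 2 * of_int d * (z / J) - of_int d ^ 2 * t)
       = of_int (d - b - b * d) + (- 2 * z - \<tau>) + - of_int c * z ^ 2 / J" .
    have "N (z + \<tau>) = expi (- of_int c * (z + \<tau>) ^ 2 / J +
        (of_int d + of_int (- b) - 2 * of_int d * (z / J) - of_int d ^ 2 * t)) * theta (z / J) t"
      unfolding N_def z theta_add_lattice[OF t(2)] by (simp only: expi_add mult.assoc)
    also have "\<dots> = - expi (- 2 * z - \<tau>) * N z"
      unfolding e N_def expi_add expi_odd_int[OF odd_det_entries(2)[OF det]] by simp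
    also have "- expi (- 2 * z - \<tau>) = expi (1 - 2 * z - \<tau>)"
      using expi_add[of 1 "- 2 * z - \<tau>"] by (simp add: algebra_simps)
    finally show ?thesis .
  qed
  have Nhol: "N holomorphic_on UNIV"
    unfolding N_def using J(2) t(2) by (intro holomorphic_intros) auto
  \<comment> \<open>The value of \<open>e\<close> is irrelevant: in the product rule it is
    multiplied by \<open>theta 0 t = 0\<close>.\<close>
  have "(\<lambda>z. expi (- of_int c * z ^ 2 / J)) holomorphic_on UNIV"
    using J(2) by (intro holomorphic_intros) auto
  then obtain e where e: "((\<lambda>z. expi (- of_int c * z ^ 2 / J)) has_field_derivative e) (at 0)"
    unfolding holomorphic_on_def field_differentiable_def by auto
  have "((\<lambda>z. z / J) has_field_derivative 1 / J) (at 0)"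
    using J(2) by (auto intro!: derivative_eq_intros)
  then have "((\<lambda>z. theta (z / J) t) has_field_derivative 1 * (1 / J)) (at 0)"
    using has_field_derivative_theta_0[OF t(2)]
    by (intro DERIV_chain2[where f = "\<lambda>z. theta z t"]) simp_all
  from DERIV_mult[OF e this] have N': "(N has_field_derivative 1 / J) (at 0)"
    using t(2) by (simp add: N_def)
  have "N z = (1 / J) / 1 * theta z \<tau>"
  proof (rule quasi_periodic_proportional[OF \<tau> Nhol _ N1 Nt])
    show "(\<lambda>z. theta z \<tau>) holomorphic_on UNIV" using \<tau> by (intro holomorphic_intros) auto
  qed (use \<tau> t(2) N' theta_add_1 theta_add_tau theta_eq_0D has_field_derivative_theta_0 in \<open>simp_all add: N_def\<close>)
  then show ?thesis by (simp add: N_def expi_minus field_simps)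
qed

section \<open>Klein forms and the eta function\<close>

lemma denom_nonzero:
  fixes a b c d :: int
  assumes "a * d - b * c = 1" "Im \<tau> > 0"
  shows "of_int c * \<tau> + of_int d \<noteq> 0"
proof
  assume eq: "of_int c * \<tau> + of_int d = 0"
  then have "Im (of_int c * \<tau> + of_int d) = 0" by simp
  then have "of_int c * Im \<tau> = 0" by simp
  with assms have "c = 0" by simp
  with eq assms show False by auto
qed

lemma Im_moebius:
  fixes a b c d :: int
  assumes "a * d - b * c = 1" "Im \<tau> > 0"
  shows "Im ((of_int a * \<tau> + of_int b) / (of_int c * \<tau> + of_int d)) > 0"
proof -
  define J where "J = of_int c * \<tau> + of_int d"
  have J: "J \<noteq> 0" unfolding J_def by (rule denom_nonzero[OF assms])
  have "Im ((of_int a * \<tau> + of_int b) / J) =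
      (of_int (a * d - b * c) * Im \<tau>) / ((Re J)\<^sup>2 + (Im J)\<^sup>2)"
    unfolding Im_divide by (simp add: J_def algebra_simps)
  also have "\<dots> > 0"
    using J assms by (auto simp: complex_neq_0)
  finally show ?thesis by (simp add: J_def)
qed

section \<open>Klein forms\<close>

text \<open>The exponential is chosen to absorb the Gaussian factor of \<open>theta_moebius\<close>.
  Up to the usual normalisation this is exp(-eta(z) z/2) sigma(z) at z = x \<tau> + y, with
  Weierstrass's sigma and quasi-period eta.\<close>

definition klein :: "complex \<Rightarrow> complex \<Rightarrow> complex \<Rightarrow> complex" where
  "klein x y \<tau> = expi (x * (x * \<tau> + y)) * theta (x * \<tau> + y) \<tau>"

text \<open>All terms containing \<open>\<tau>\<close> cancel; what remains is a constant, a root of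
  unity for rational \<open>x\<close> and \<open>y\<close>.\<close>

lemma klein_add_int:
  fixes m n :: int
  assumes "Im \<tau> > 0"
  shows "klein (x + of_int m) (y + of_int n) \<tau> =
    expi (of_int (m + n + m * n) + (x * of_int n - of_int m * y)) * klein x y \<tau>"
proof -
  have z: "(x + of_int m) * \<tau> + (y + of_int n) = (x * \<tau> + y) + of_int m * \<tau> + of_int n"
    by (simp add: algebra_simps)
  have e: "(x + of_int m) * (x * \<tau> + y + of_int m * \<tau> + of_int n) +
      (of_int m + of_int n - 2 * of_int m * (x * \<tau> + y) - of_int m ^ 2 * \<tau>) =
      (of_int (m + n + m * n) + (x * of_int n - of_int m * y)) + x * (x * \<tau> + y)"
    by (simp add: algebra_simps power2_eq_square)
  show ?thesis
    unfolding klein_def z theta_add_lattice[OF assms]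
    by (simp only: mult.assoc[symmetric] expi_add[symmetric] e)
qed

lemma klein_moebius:
  fixes a b c d :: int
  assumes det: "a * d - b * c = 1" and \<tau>: "Im \<tau> > 0"
  defines "J \<equiv> of_int c * \<tau> + of_int d"
  shows "klein x y ((of_int a * \<tau> + of_int b) / J) =
    klein (x * of_int a + y * of_int c) (x * of_int b + y * of_int d) \<tau> / J"
proof -
  define t where "t = (of_int a * \<tau> + of_int b) / J"
  define z where "z = (x * of_int a + y * of_int c) * \<tau> + (x * of_int b + y * of_int d)"
  have J: "J \<noteq> 0" unfolding J_def by (rule denom_nonzero[OF det \<tau>])
  have t: "Im t > 0" unfolding t_def J_def by (rule Im_moebius[OF det \<tau>])
  have det': "of_int a * of_int d - of_int b * of_int c = (1 :: complex)"
    using det by (metis of_int_1 of_int_diff of_int_mult)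
  \<comment> \<open>The point with coordinates (x, y) in the lattice of \<open>t\<close> is
    \<open>z / J\<close>, where \<open>z\<close> has the coordinates (x, y)A in the lattice of
    \<open>\<tau>\<close>.\<close>
  have zt: "x * t + y = z / J"
    unfolding t_def z_def using J by (simp add: field_simps) (simp add: J_def algebra_simps)
  have "x + of_int c * z = x * (of_int a * of_int d - of_int b * of_int c) + of_int c * z"
    unfolding det' by simp
  also have "\<dots> = (x * of_int a + y * of_int c) * J"
    unfolding z_def J_def by (simp add: algebra_simps)
  finally have "z * (x + of_int c * z) / J = (x * of_int a + y * of_int c) * z"
    using J by simp
  then have e: "x * (z / J) + of_int c * z ^ 2 / J = (x * of_int a + y * of_int c) * z"
    using J by (simp add: field_simps power2_eq_square)
  have "klein x y t = expi (x * (z / J)) * (expi (of_int c * z ^ 2 / J) / J * theta z \<tau>)"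
    unfolding klein_def zt
    by (subst theta_moebius[OF det \<tau> J_def[THEN meta_eq_to_obj_eq] J t_def t]) (rule refl)
  also have "\<dots> = expi (x * (z / J) + of_int c * z ^ 2 / J) * theta z \<tau> / J"
    unfolding expi_add by simp
  also have "\<dots> = klein (x * of_int a + y * of_int c) (x * of_int b + y * of_int d) \<tau> / J"
    unfolding e unfolding klein_def z_def ..
  finally show ?thesis unfolding t_def .
qed

section \<open>Points of order 2 and the 24th power of eta\<close>

lemma dedekind_eta_eq_qpoch:
  "dedekind_eta \<tau> = expi (\<tau> / 12) * qpoch (expi (2 * \<tau>)) (expi (2 * \<tau>))"
proof -
  have "exp (2 * of_real pi * \<i> * \<tau>) = expi (2 * \<tau>)" "exp (2 * of_real pi * \<i> * \<tau> / 24) = expi (\<tau> / 12)"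
    by (simp_all add: expi_def mult_ac)
  then show ?thesis by (simp add: dedekind_eta_def qpoch_def)
qed

lemma dedekind_eta_nonzero:
  assumes "Im \<tau> > 0"
  shows "dedekind_eta \<tau> \<noteq> 0"
proof -
  have "norm (expi (2 * \<tau>)) < 1" using assms by (intro norm_expi_less_1) simp
  then show ?thesis unfolding dedekind_eta_eq_qpoch using qpoch_nonzero by simp
qed

text \<open>Euler's identity between partitions into distinct and into odd parts, with s a square
  root of q: the first two factors combine to (q; q^2), which is the inverse of (-q; q).\<close>

lemma qpoch_euler:
  assumes "norm s < 1"
  shows "qpoch s (s\<^sup>2) * qpoch (- s) (s\<^sup>2) * qpoch (- (s\<^sup>2)) (s\<^sup>2) = 1"
proof -
  define q where "q = s\<^sup>2"
  have q: "norm q < 1" using assms by (simp add: q_def norm_power power_less_one_iff)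
  have q2: "norm (q\<^sup>2) < 1" using q by (simp add: norm_power power_less_one_iff)
  have 1: "qpoch s q * qpoch (- s) q = qpoch q (q\<^sup>2)"
    using qpoch_mult_minus[OF q, of s] by (simp add: q_def)
  have 2: "qpoch q q * qpoch (- q) q = qpoch (q\<^sup>2) (q\<^sup>2)"
    by (rule qpoch_mult_minus[OF q])
  have 3: "qpoch q (q\<^sup>2) * qpoch (q\<^sup>2) (q\<^sup>2) = qpoch q q"
    using qpoch_split_residues[OF q, of 2 q] by (simp add: numeral_2_eq_2)
  have "qpoch q q * (qpoch q (q\<^sup>2) * qpoch (- q) q) = qpoch q q * 1"
    using 2 3 by (metis mult.left_commute mult.right_neutral mult.commute)
  then have "qpoch q (q\<^sup>2) * qpoch (- q) q = 1"
    using qpoch_nonzero[OF q q] by simp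
  then show ?thesis unfolding 1[symmetric] unfolding q_def .
qed

text \<open>The three numerators are the squares of the three factors in Euler's identity, so only
  E^-6 survives, and it cancels against eta^6. The powers of q cancel as well. The 2 comes from the
  first factor of \<open>qpoch (-1) q\<close>.\<close>

lemma klein_half_product:
  assumes \<tau>: "Im \<tau> > 0"
  shows "klein (1/2) 0 \<tau> * klein 0 (1/2) \<tau> * klein (1/2) (1/2) \<tau> * dedekind_eta \<tau> ^ 6 =
    - 2 * expi (- 3/4) / (2 * of_real pi * \<i>) ^ 3"
proof -
  define s where "s = expi \<tau>"
  define q where "q = s\<^sup>2"
  define E where "E = qpoch q q"
  define w where "w = 2 * of_real pi * \<i> * E\<^sup>2"
  have s: "norm s < 1" unfolding s_def using \<tau> by (rule norm_expi_less_1)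
  have q: "norm q < 1" using s by (simp add: q_def norm_power power_less_one_iff)
  have eq: "expi (2 * \<tau>) = q" using expi_mult_of_nat[of 2 \<tau>] by (simp add: q_def s_def)
  have E: "E \<noteq> 0" unfolding E_def by (rule qpoch_nonzero[OF q q])
  have m1: "qpoch (-1) q = 2 * qpoch (- q) q" using qpoch_rec[OF q, of "-1"] by simp
  have e1: "expi (2 * \<tau> - 1) = - q" using expi_diff[of "2 * \<tau>" 1] by (simp add: eq)
  have e2: "expi (\<tau> + 1) = - s" using expi_add[of \<tau> 1] by (simp add: s_def)
  have e3: "expi (\<tau> - 1) = - s" using expi_diff[of \<tau> 1] by (simp add: s_def)
  have k1: "klein (1/2) 0 \<tau> = - expi (\<tau> / 4) * expi (- \<tau> / 2) * qpoch s q ^ 2 / w"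
    unfolding klein_def theta_def eq E_def[symmetric] w_def
    by (simp add: s_def power2_eq_square mult_ac)
  have k2: "klein 0 (1/2) \<tau> = - 2 * expi (- 1/2) * qpoch (- q) q ^ 2 / w"
    unfolding klein_def theta_def eq E_def[symmetric] w_def
    by (simp add: e1[unfolded mult.commute[of 2]] m1 power2_eq_square mult_ac)
  have k3: "klein (1/2) (1/2) \<tau> = - expi (\<tau> / 4 + 1/4) * expi (- (\<tau> / 2) - 1/2) * qpoch (- s) q ^ 2 / w"
  proof -
    have "2 * (1/2 * \<tau> + 1/2) = \<tau> + 1" "2 * \<tau> - 2 * (1/2 * \<tau> + 1/2) = \<tau> - 1"
       "1/2 * (1/2 * \<tau> + 1/2) = \<tau> / 4 + 1/4" "- (1/2 * \<tau> + 1/2) = - (\<tau> / 2) - 1/2"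
      by (simp_all add: field_simps)
    then show ?thesis
      unfolding klein_def theta_def eq E_def[symmetric] w_def
      by (simp only: e2 e3 power2_eq_square) (simp add: mult_ac)
  qed
  have ee: "expi (\<tau> / 4) * expi (- \<tau> / 2) * expi (- 1/2) * expi (\<tau> / 4 + 1/4) * expi (- (\<tau> / 2) - 1/2) *
      expi (\<tau> / 12) ^ 6 = expi (- 3/4)"
    unfolding expi_mult_of_nat[symmetric] expi_add[symmetric] by (rule arg_cong[of _ _ expi]) simp
  have ww: "w ^ 3 = (2 * of_real pi * \<i>) ^ 3 * E ^ 6"
    unfolding w_def by (simp only: power_mult_distrib power_mult[symmetric]) simp
  have "klein (1/2) 0 \<tau> * klein 0 (1/2) \<tau> * klein (1/2) (1/2) \<tau> * dedekind_eta \<tau> ^ 6 =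
     - 2 * (expi (\<tau> / 4) * expi (- \<tau> / 2) * expi (- 1/2) * expi (\<tau> / 4 + 1/4) * expi (- (\<tau> / 2) - 1/2) *
      expi (\<tau> / 12) ^ 6) * (qpoch s q * qpoch (- s) q * qpoch (- q) q) ^ 2 * (E ^ 6 / w ^ 3)"
    unfolding k1 k2 k3 dedekind_eta_eq_qpoch eq E_def[symmetric]
    by (simp add: power_mult_distrib power2_eq_square power3_eq_cube mult_ac)
  also have "\<dots> = - 2 * expi (- 3/4) * (E ^ 6 / w ^ 3)"
    unfolding ee using qpoch_euler[OF s] by (simp add: q_def)
  also have "\<dots> = - 2 * expi (- 3/4) / (2 * of_real pi * \<i>) ^ 3"
    unfolding ww using E by simp
  finally show ?thesis .
qed

text \<open>Integral shifts of a point of order 2 produce 4th roots of unity.\<close>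

lemma klein_half_power4_parity:
  fixes x y :: int
  assumes \<tau>: "Im \<tau> > 0"
  shows "klein (of_int x / 2) (of_int y / 2) \<tau> ^ 4 =
    klein (of_bool (odd x) / 2) (of_bool (odd y) / 2) \<tau> ^ 4"
proof -
  define m n where "m = x div 2" and "n = y div 2"
  have x: "x = of_bool (odd x) + 2 * m" and y: "y = of_bool (odd y) + 2 * n"
    by (auto simp: m_def n_def elim!: oddE)
  have xc: "of_int x / 2 = of_bool (odd x) / 2 + (of_int m :: complex)"
    and yc: "of_int y / 2 = of_bool (odd y) / 2 + (of_int n :: complex)"
    by (subst x, simp add: field_simps) (subst y, simp add: field_simps)
  define k where "k = 2 * (m + n + m * n) + (of_bool (odd x) * n - m * of_bool (odd y))"
  have "expi (of_int (m + n + m * n) + (of_bool (odd x) / 2 * of_int n - of_int m * (of_bool (odd y) / 2))) ^ 4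
      = expi (2 * of_int k)"
    unfolding expi_mult_of_nat[symmetric] k_def by (rule arg_cong[of _ _ expi]) (simp add: algebra_simps)
  then show ?thesis
    unfolding xc yc klein_add_int[OF \<tau>] power_mult_distrib by simp
qed

text \<open>The fourth power of the product \<open>V\<close> has weight -12: the matrix permutes the
  points of order 2 up to integral shifts, whose roots of unity vanish in the fourth power.\<close>

lemma eta_power24_moebius:
  fixes a b c d :: int
  assumes det: "a * d - b * c = 1" and \<tau>: "Im \<tau> > 0"
  defines "J \<equiv> of_int c * \<tau> + of_int d"
  shows "dedekind_eta ((of_int a * \<tau> + of_int b) / J) ^ 24 = J ^ 12 * dedekind_eta \<tau> ^ 24"
proof -
  define t where "t = (of_int a * \<tau> + of_int b) / J"
  have J: "J \<noteq> 0" unfolding J_def by (rule denom_nonzero[OF det \<tau>])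
  have t: "Im t > 0" unfolding t_def J_def by (rule Im_moebius[OF det \<tau>])
  define V where "V = (\<lambda>\<tau>. klein (1/2) 0 \<tau> * klein 0 (1/2) \<tau> * klein (1/2) (1/2) \<tau>)"
  define K where "K = - 2 * expi (- 3/4) / (2 * of_real pi * \<i>) ^ 3"
  have V: "V w ^ 4 * dedekind_eta w ^ 24 = K ^ 4" if "Im w > 0" for w
  proof -
    have "V w ^ 4 * dedekind_eta w ^ 24 = (V w * dedekind_eta w ^ 6) ^ 4"
      by (simp add: power_mult_distrib flip: power_mult)
    also have "V w * dedekind_eta w ^ 6 = K"
      unfolding V_def K_def by (rule klein_half_product[OF that])
    finally show ?thesis .
  qed
  have K: "K \<noteq> 0" by (simp add: K_def)
  define g where "g = (\<lambda>x y :: int. klein (of_int x / 2) (of_int y / 2) \<tau> ^ 4)"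
  define H where "H = (\<lambda>x y :: bool. klein (of_bool x / 2) (of_bool y / 2) \<tau> ^ 4)"
  have gH: "g x y = H (odd x) (odd y)" for x y
    unfolding g_def H_def by (rule klein_half_power4_parity[OF \<tau>])
  have "odd (a * d - b * c)" using det by simp
  \<comment> \<open>Modulo 2, the rows (a, b) and (c, d) and their sum are the three nonzero vectors
    in some order.\<close>
  then have perm: "g a b * g c d * g (a + c) (b + d) = g 1 0 * g 0 1 * g 1 1"
    unfolding gH by (cases "even a"; cases "even b"; cases "even c"; cases "even d") (simp_all add: mult_ac)
  have kt: "klein (1/2) 0 t = klein (of_int a / 2) (of_int b / 2) \<tau> / J"
    "klein 0 (1/2) t = klein (of_int c / 2) (of_int d / 2) \<tau> / J"
    "klein (1/2) (1/2) t = klein (of_int (a + c) / 2) (of_int (b + d) / 2) \<tau> / J"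
    unfolding t_def J_def klein_moebius[OF det \<tau>] by (simp_all add: add_divide_distrib)
  have "x / J * (y / J) * (z / J) * J ^ 3 = x * y * z" for x y z
    using J by (simp add: power3_eq_cube)
  then have "V t * J ^ 3 = klein (of_int a / 2) (of_int b / 2) \<tau> * klein (of_int c / 2) (of_int d / 2) \<tau> *
      klein (of_int (a + c) / 2) (of_int (b + d) / 2) \<tau>"
    unfolding V_def kt .
  then have "(V t * J ^ 3) ^ 4 = g a b * g c d * g (a + c) (b + d)"
    unfolding g_def by (simp only: power_mult_distrib)
  then have "V t ^ 4 * J ^ 12 = g a b * g c d * g (a + c) (b + d)"
    by (simp add: power_mult_distrib flip: power_mult)
  also have "\<dots> = V \<tau> ^ 4"
    unfolding perm unfolding g_def V_def by (simp add: power_mult_distrib)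
  finally have VJ: "V t ^ 4 * J ^ 12 = V \<tau> ^ 4" .
  have "V t ^ 4 \<noteq> 0" using V[OF t] K by auto
  moreover have "V t ^ 4 * dedekind_eta t ^ 24 = V t ^ 4 * (J ^ 12 * dedekind_eta \<tau> ^ 24)"
    using V[OF t] V[OF \<tau>] VJ by (metis mult.assoc)
  ultimately show ?thesis unfolding t_def by simp
qed

section \<open>Points of order p and the quotient of eta at \<tau> by the p-th power of eta at p
  \<tau>\<close>

lemma sum_of_nat_complex: "(\<Sum>j=1..n. of_nat j :: complex) = of_nat n * (of_nat n + 1) / 2"
  by (induction n) (simp_all add: field_simps)

lemma sum_of_nat_squares_complex:
  "(\<Sum>j=1..n. of_nat j ^ 2 :: complex) = of_nat n * (of_nat n + 1) * (2 * of_nat n + 1) / 6"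
  by (induction n) (simp_all add: field_simps power2_eq_square)

lemma prod_expi: "(\<Prod>j\<in>I. expi (f j)) = expi (\<Sum>j\<in>I. f j)"
  by (induction I rule: infinite_finite_induct) (simp_all add: expi_add)

text \<open>Each Klein form contributes the residues \<open>j\<close> and \<open>p - j\<close>
  modulo \<open>p\<close>. Over \<open>j \<le> n\<close> these are all nonzero residues, and the
  factor \<open>E\<close> for residue 0 completes them to \<open>qpoch q q\<close>; this factor is
  what remains of \<open>E ^ p\<close> over the denominators \<open>E ^ (2 * n)\<close>.\<close>

lemma prod_klein_eq_eta_quotient:
  fixes n p :: nat
  assumes \<tau>: "Im \<tau> > 0" and p: "p = 2 * n + 1"
  shows "(\<Prod>j=1..n. klein (of_nat j / of_nat p) 0 (of_nat p * \<tau>)) * dedekind_eta (of_nat p * \<tau>) ^ p =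
    (- 1 / (2 * of_real pi * \<i>)) ^ n * dedekind_eta \<tau>"
proof -
  define q where "q = expi (2 * \<tau>)"
  define Q where "Q = q ^ p"
  define E where "E = qpoch Q Q"
  define w where "w = 2 * of_real pi * \<i>"
  have p0: "of_nat p \<noteq> (0 :: complex)" unfolding of_nat_eq_0_iff using p by simp
  have q: "norm q < 1" unfolding q_def using \<tau> by (intro norm_expi_less_1) simp
  have "p > 0" using p by simp
  then have Q: "norm Q < 1" using q by (simp add: Q_def norm_power power_less_one_iff)
  have E: "E \<noteq> 0" unfolding E_def by (rule qpoch_nonzero[OF Q Q])
  have eQ: "expi (2 * (of_nat p * \<tau>)) = Q"
    using expi_mult_of_nat[of p "2 * \<tau>"] by (simp add: Q_def q_def mult_ac)
  have k: "klein (of_nat j / of_nat p) 0 (of_nat p * \<tau>) =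
     (- 1 / w / E\<^sup>2) * expi ((of_nat j ^ 2 / of_nat p - of_nat j) * \<tau>) * (qpoch (q ^ j) Q * qpoch (q ^ (p - j)) Q)"
    if "j \<in> {1..n}" for j
  proof -
    have z: "of_nat j / of_nat p * (of_nat p * \<tau>) + 0 = of_nat j * \<tau>" using p0 by simp
    have e1: "expi (2 * (of_nat j * \<tau>)) = q ^ j"
      using expi_mult_of_nat[of j "2 * \<tau>"] by (simp add: q_def mult_ac)
    have "2 * (of_nat p * \<tau>) - 2 * (of_nat j * \<tau>) = of_nat (p - j) * (2 * \<tau>)"
      using that p by (simp add: of_nat_diff algebra_simps)
    then have e2: "expi (2 * (of_nat p * \<tau>) - 2 * (of_nat j * \<tau>)) = q ^ (p - j)"
      by (simp only: expi_mult_of_nat q_def)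
    have "expi (of_nat j / of_nat p * (of_nat j * \<tau>)) * expi (- (of_nat j * \<tau>)) =
       expi ((of_nat j ^ 2 / of_nat p - of_nat j) * \<tau>)"
      unfolding expi_add[symmetric] by (rule arg_cong[of _ _ expi]) (simp add: algebra_simps power2_eq_square)
    then show ?thesis
      unfolding klein_def theta_def z e1 e2 eQ E_def[symmetric] w_def by (simp add: mult_ac)
  qed
  have "(\<Prod>j=1..n. qpoch (q ^ (p - j)) Q) = (\<Prod>j=n+1..2*n. qpoch (q ^ j) Q)"
    by (rule prod.reindex_bij_witness[of _ "\<lambda>j. p - j" "\<lambda>j. p - j"]) (use p in auto)
  moreover have "(\<Prod>j=1..2*n. qpoch (q ^ j) Q) = (\<Prod>j=1..n. qpoch (q ^ j) Q) * (\<Prod>j=n+1..2*n. qpoch (q ^ j) Q)"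
    using prod.ub_add_nat[of 1 n "\<lambda>j. qpoch (q ^ j) Q" n] by (simp add: mult_2)
  ultimately have pq: "(\<Prod>j=1..n. qpoch (q ^ j) Q * qpoch (q ^ (p - j)) Q) = (\<Prod>j=1..2*n. qpoch (q ^ j) Q)"
    by (simp add: prod.distrib)
  have "qpoch q q = (\<Prod>j<p. qpoch (q * q ^ j) Q)"
    unfolding Q_def by (rule qpoch_split_residues[OF q, symmetric]) (simp add: p)
  also have "\<dots> = (\<Prod>j<2*n. qpoch (q ^ Suc j) Q) * E"
    unfolding p E_def by (simp add: Q_def p)
  also have "(\<Prod>j<2*n. qpoch (q ^ Suc j) Q) = (\<Prod>j=1..2*n. qpoch (q ^ j) Q)"
    by (rule prod.reindex_bij_witness[of _ "\<lambda>j. j - 1" Suc]) auto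
  finally have split: "(\<Prod>j=1..2*n. qpoch (q ^ j) Q) * E = qpoch q q" by simp
  \<comment> \<open>The sum over \<open>j\<close> equals (1 - p^2) \<tau>/12, and the eta factor
    adds p^2 \<tau>/12; this leaves the exponent of eta at \<open>\<tau>\<close>.\<close>
  have sum: "(\<Sum>j=1..n. (of_nat j ^ 2 / of_nat p - of_nat j) * \<tau>) + of_nat p * (of_nat p * \<tau> / 12) = \<tau> / 12"
  proof -
    have pc: "2 * of_nat n + 1 = (of_nat p :: complex)" by (simp add: p)
    have "(\<Sum>j=1..n. (of_nat j ^ 2 / of_nat p - of_nat j) * \<tau>) =
        ((\<Sum>j=1..n. of_nat j ^ 2) / of_nat p - (\<Sum>j=1..n. of_nat j)) * \<tau>"
      by (simp only: sum_distrib_right[symmetric] sum_divide_distrib sum_subtractf)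
    also have "\<dots> = (of_nat n * (of_nat n + 1) / 6 - of_nat n * (of_nat n + 1) / 2) * \<tau>"
      unfolding sum_of_nat_complex sum_of_nat_squares_complex pc using p0 by simp
    finally show ?thesis by (simp add: p field_simps)
  qed
  have "(\<Prod>j=1..n. klein (of_nat j / of_nat p) 0 (of_nat p * \<tau>)) =
     (- 1 / w / E\<^sup>2) ^ n * expi (\<Sum>j=1..n. (of_nat j ^ 2 / of_nat p - of_nat j) * \<tau>) * (\<Prod>j=1..2*n. qpoch (q ^ j) Q)"
  proof -
    have "(\<Prod>j=1..n. klein (of_nat j / of_nat p) 0 (of_nat p * \<tau>)) =
      (\<Prod>j=1..n. (- 1 / w / E\<^sup>2) * expi ((of_nat j ^ 2 / of_nat p - of_nat j) * \<tau>) * (qpoch (q ^ j) Q * qpoch (q ^ (p - j)) Q))"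
      by (intro prod.cong refl k)
    then show ?thesis
      unfolding pq[symmetric] prod_expi[symmetric] by (simp only: prod.distrib prod_constant card_atLeastAtMost diff_Suc_1)
  qed
  then have "(\<Prod>j=1..n. klein (of_nat j / of_nat p) 0 (of_nat p * \<tau>)) * dedekind_eta (of_nat p * \<tau>) ^ p =
     (- 1 / w / E\<^sup>2) ^ n * (expi (\<Sum>j=1..n. (of_nat j ^ 2 / of_nat p - of_nat j) * \<tau>) * expi (of_nat p * \<tau> / 12) ^ p) *
     (\<Prod>j=1..2*n. qpoch (q ^ j) Q) * E ^ p"
    unfolding dedekind_eta_eq_qpoch[of "of_nat p * \<tau>"] eQ E_def[symmetric]
    by (simp add: power_mult_distrib mult_ac)
  also have "expi (\<Sum>j=1..n. (of_nat j ^ 2 / of_nat p - of_nat j) * \<tau>) * expi (of_nat p * \<tau> / 12) ^ p = expi (\<tau> / 12)"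
    by (simp only: expi_mult_of_nat[symmetric] expi_add[symmetric] sum)
  also have "(- 1 / w / E\<^sup>2) ^ n * expi (\<tau> / 12) * (\<Prod>j=1..2*n. qpoch (q ^ j) Q) * E ^ p =
      (- 1 / w) ^ n * expi (\<tau> / 12) * ((\<Prod>j=1..2*n. qpoch (q ^ j) Q) * E)"
  proof -
    have "(- 1 / w / E\<^sup>2) ^ n * E ^ p = (- 1 / w / E\<^sup>2 * E\<^sup>2) ^ n * E"
      by (simp only: p power_add power_mult power_mult_distrib power_one_right mult.assoc)
    then have *: "(- 1 / w / E\<^sup>2) ^ n * E ^ p = (- 1 / w) ^ n * E"
      using E by simp
    have "x * y * z * u = (x * u) * y * z" for x y z u :: complex by (simp only: mult_ac)
    then have "(- 1 / w / E\<^sup>2) ^ n * expi (\<tau> / 12) * (\<Prod>j=1..2*n. qpoch (q ^ j) Q) * E ^ p =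
       ((- 1 / w / E\<^sup>2) ^ n * E ^ p) * expi (\<tau> / 12) * (\<Prod>j=1..2*n. qpoch (q ^ j) Q)" .
    then show ?thesis unfolding * by (simp only: mult_ac)
  qed
  also have "\<dots> = (- 1 / w) ^ n * dedekind_eta \<tau>"
    unfolding split unfolding dedekind_eta_eq_qpoch q_def by simp
  finally show ?thesis unfolding w_def .
qed

text \<open>The root of unity produced by the integral shifts is \<open>(-1)\<close> to the power \<open>M m (b + 1)\<close>, and it
  is 1 because \<open>m\<close> odd and \<open>b\<close> even would make the first row \<open>(a, b)\<close> even.\<close>

lemma klein_moebius_Gamma1:
  fixes a b c d m :: int and n p M :: nat
  assumes det: "a * d - b * (int p * c) = 1" and a: "a = 1 + int p * m" and \<tau>: "Im \<tau> > 0"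
    and p: "p = 2 * n + 1" and M: "n * (n + 1) = 6 * M"
  defines "J \<equiv> of_int (int p * c) * \<tau> + of_int d"
  shows "(\<Prod>j=1..n. klein (of_nat j / of_nat p) 0 (of_nat p * ((of_int a * \<tau> + of_int b) / J))) =
    (\<Prod>j=1..n. klein (of_nat j / of_nat p) 0 (of_nat p * \<tau>)) / J ^ n"
proof -
  have p0: "of_nat p \<noteq> (0 :: complex)" unfolding of_nat_eq_0_iff using p by simp
  \<comment> \<open>Conjugation by diag(p, 1) turns (a, b; pc, d) into (a, pb; c, d), which acts on
    \<open>p * \<tau>\<close> with the same automorphy factor \<open>J\<close>.\<close>
  have det': "a * d - (int p * b) * c = 1" using det by (simp add: mult_ac)
  have \<tau>': "Im (of_nat p * \<tau>) > 0" using \<tau> p by simp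
  define e where "e = (\<lambda>j::nat. of_int (int j * m + int j * b + int j * m * (int j * b)) +
      (of_nat j / of_nat p * of_int (int j * b) - of_int (int j * m) * 0 :: complex))"
  have J': "J = of_int c * (of_nat p * \<tau>) + of_int d" by (simp add: J_def mult_ac)
  have pt: "of_nat p * ((of_int a * \<tau> + of_int b) / J) =
      (of_int a * (of_nat p * \<tau>) + of_int (int p * b)) / (of_int c * (of_nat p * \<tau>) + of_int d)"
    unfolding J'[symmetric] by (simp add: algebra_simps)
  have kt: "klein (of_nat j / of_nat p) 0 (of_nat p * ((of_int a * \<tau> + of_int b) / J)) =
      expi (e j) * klein (of_nat j / of_nat p) 0 (of_nat p * \<tau>) / J" for j
  proof -
    \<comment> \<open>As \<open>a\<close> is 1 modulo \<open>p\<close>, the point (j/p, 0) moves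
      only by the integral vector (jm, jb).\<close>
    have x: "of_nat j / of_nat p * of_int a + 0 * of_int c = of_nat j / of_nat p + (of_int (int j * m) :: complex)"
      using p0 by (simp add: a field_simps)
    have y: "of_nat j / of_nat p * of_int (int p * b) + 0 * of_int d = 0 + (of_int (int j * b) :: complex)"
      using p0 by simp
    show ?thesis
      unfolding pt klein_moebius[OF det' \<tau>'] x y klein_add_int[OF \<tau>']
      unfolding J' e_def by (rule refl)
  qed
  have M': "of_nat n * (of_nat n + 1) = (6 * of_nat M :: complex)"
    using arg_cong[OF M, of "of_nat :: nat \<Rightarrow> complex"] by (simp add: algebra_simps)
  \<comment> \<open>Integrality of \<open>M = n (n + 1) / 6\<close> makes the sum of squares
    divisible by \<open>p\<close>, which clears the denominator of \<open>e\<close>.\<close>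
  have s1: "(\<Sum>j=1..n. of_nat j :: complex) = 3 * of_nat M"
    unfolding sum_of_nat_complex M' by simp
  have s2: "(\<Sum>j=1..n. of_nat j ^ 2 :: complex) = of_nat p * of_nat M"
    unfolding sum_of_nat_squares_complex M' by (simp add: p)
  define N where "N = int M * (3 * (m + b) + int p * (m * b) + b)"
  have "(\<Sum>j=1..n. e j) = (\<Sum>j=1..n. of_nat j * of_int (m + b) + of_nat j ^ 2 * (of_int (m * b) + of_int b / of_nat p))"
    by (intro sum.cong refl) (simp add: e_def algebra_simps power2_eq_square)
  also have "\<dots> = (\<Sum>j=1..n. of_nat j) * of_int (m + b) + (\<Sum>j=1..n. of_nat j ^ 2) * (of_int (m * b) + of_int b / of_nat p)"
    by (simp only: sum.distrib sum_distrib_right)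
  also have "\<dots> = of_int N"
    unfolding s1 s2 N_def using p0 by (simp add: field_simps)
  finally have "(\<Sum>j=1..n. e j) = of_int N" .
  moreover have "even N"
  proof -
    have "odd (int p)" by (simp add: p)
    moreover have "odd (a * d - b * (int p * c))" using det by simp
    ultimately show ?thesis unfolding N_def a by auto
  qed
  then obtain l where "N = 2 * l" by blast
  ultimately have "expi (\<Sum>j=1..n. e j) = 1" by simp
  then show ?thesis
    unfolding kt by (simp add: prod.distrib prod_dividef prod_expi)
qed

lemma eta_quotient_Gamma1:
  fixes a b c d m :: int and n p M :: nat
  assumes det: "a * d - b * (int p * c) = 1" and a: "a = 1 + int p * m" and \<tau>: "Im \<tau> > 0"
    and p: "p = 2 * n + 1" and M: "n * (n + 1) = 6 * M"
  defines "J \<equiv> of_int (int p * c) * \<tau> + of_int d"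
  defines "t \<equiv> (of_int a * \<tau> + of_int b) / J"
  shows "dedekind_eta t / dedekind_eta (of_nat p * t) ^ p =
    dedekind_eta \<tau> / dedekind_eta (of_nat p * \<tau>) ^ p / J ^ n"
proof -
  define K where "K = (\<lambda>\<tau>. \<Prod>j=1..n. klein (of_nat j / of_nat p) 0 (of_nat p * \<tau>))"
  define u :: complex where "u = (- 1 / (2 * of_real pi * \<i>)) ^ n"
  have u: "u \<noteq> 0" by (simp add: u_def)
  have Im_p: "Im (of_nat p * w) > 0" if "Im w > 0" for w using that p by simp
  have K: "dedekind_eta w / dedekind_eta (of_nat p * w) ^ p = K w / u" if "Im w > 0" for w
    using prod_klein_eq_eta_quotient[OF that p] dedekind_eta_nonzero[OF Im_p[OF that]] u
    unfolding K_def u_def[symmetric] by (simp add: field_simps)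
  have t: "Im t > 0" unfolding t_def J_def by (rule Im_moebius[OF det \<tau>])
  have "K t = K \<tau> / J ^ n"
    unfolding K_def t_def J_def by (rule klein_moebius_Gamma1[OF det a \<tau> p M])
  then show ?thesis unfolding K[OF t] K[OF \<tau>] by simp
qed

section \<open>Eta quotients\<close>

lemma mem_upper_half_plane: "\<tau> \<in> upper_half_plane \<longleftrightarrow> Im \<tau> > 0"
  by (simp add: upper_half_plane_def)

lemma open_upper_half_plane: "open upper_half_plane"
  unfolding upper_half_plane_def by (rule open_halfspace_Im_gt)

lemma connected_upper_half_plane: "connected upper_half_plane"
  unfolding upper_half_plane_def by (intro convex_connected convex_halfspace_Im_gt)

lemma SL2Z_iff: "A \<in> SL2Z \<longleftrightarrow> A $ 1 $ 1 * A $ 2 $ 2 - A $ 1 $ 2 * A $ 2 $ 1 = 1" for A :: "int^2^2"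
  by (simp add: SL2Z_def det_2)

lemma holomorphic_on_dedekind_eta:
  "f holomorphic_on S \<Longrightarrow> open S \<Longrightarrow> (\<And>z. z \<in> S \<Longrightarrow> Im (f z) > 0) \<Longrightarrow>
    (\<lambda>z. dedekind_eta (f z)) holomorphic_on S"
  unfolding dedekind_eta_eq_qpoch
  by (intro holomorphic_intros) (auto intro!: norm_expi_less_1)

lemma dedekind_eta_add_int: "dedekind_eta (\<tau> + of_int n) = expi (of_int n / 12) * dedekind_eta \<tau>"
proof -
  have "expi (2 * (\<tau> + of_int n)) = expi (2 * \<tau>)" by (simp add: ring_distribs expi_add)
  then show ?thesis by (simp add: dedekind_eta_eq_qpoch add_divide_distrib expi_add mult_ac)
qed

definition eta_quotient :: "nat \<Rightarrow> int \<Rightarrow> int \<Rightarrow> complex \<Rightarrow> complex" where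
  "eta_quotient p r s \<tau> = dedekind_eta \<tau> powi r * dedekind_eta (of_nat p * \<tau>) powi s"

lemma eta_quotient_nonzero:
  assumes "Im \<tau> > 0" "p > 0"
  shows "eta_quotient p r s \<tau> \<noteq> 0"
  using assms dedekind_eta_nonzero[of \<tau>] dedekind_eta_nonzero[of "of_nat p * \<tau>"]
  by (simp add: eta_quotient_def)

lemma power_int_power_left: "(x ^ n) powi e = x powi (int n * e)" for x :: complex
  by (simp add: power_int_mult)

section \<open>Invariance under \<Gamma>_1(p)\<close>

lemma eta_quotient_slash_Gamma1:
  fixes r s k :: int and p n M :: nat
  assumes A: "A \<in> Gamma1 p" and \<tau>: "Im \<tau> > 0" and p: "p = 2 * n + 1" and M: "n * (n + 1) = 6 * M"
    and weight: "r + s = 2 * k" and dvd: "24 dvd int p * r + s"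
  shows "slash k (eta_quotient p r s) A \<tau> = eta_quotient p r s \<tau>"
proof -
  define a b c d where "a = A $ 1 $ 1" "b = A $ 1 $ 2" "c = A $ 2 $ 1" "d = A $ 2 $ 2"
  note abcd = this
  have det: "a * d - b * c = 1" and "[a = 1] (mod int p)" and "[c = 0] (mod int p)"
    using A by (simp_all add: Gamma1_def SL2Z_iff abcd)
  then obtain m c' where a: "a = 1 + int p * m" and c: "c = int p * c'"
    unfolding cong_iff_lin by (metis add.commute cong_0_iff cong_iff_lin cong_sym dvdE mult.commute)
  obtain e where e: "int p * r + s = 24 * e" using dvd by blast
  define J where "J = of_int c * \<tau> + of_int d"
  define t where "t = (of_int a * \<tau> + of_int b) / J"
  have J: "J \<noteq> 0" unfolding J_def by (rule denom_nonzero[OF det \<tau>])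
  have t: "Im t > 0" unfolding t_def J_def by (rule Im_moebius[OF det \<tau>])
  have Im_p: "Im (of_nat p * w) > 0" if "Im w > 0" for w using that p by simp
  have det1: "a * d - b * (int p * c') = 1" using det c by simp
  have det2: "a * d - (int p * b) * c' = 1" using det c by (simp add: mult_ac)
  have fe: "eta_quotient p r s w =
      (dedekind_eta w / dedekind_eta (of_nat p * w) ^ p) powi r * (dedekind_eta (of_nat p * w) ^ 24) powi e"
    if "Im w > 0" for w
  proof -
    define x y where "x = dedekind_eta w" "y = dedekind_eta (of_nat p * w)"
    have y: "y \<noteq> 0" unfolding x_y_def using dedekind_eta_nonzero Im_p that by blast
    have "(x / y ^ p) powi r * (y ^ 24) powi e = x powi r / y powi (int p * r) * y powi (int p * r + s)"
      unfolding power_int_divide_distrib power_int_power_left e by simp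
    also have "\<dots> = x powi r * y powi s"
      using y by (simp add: power_int_add)
    finally show ?thesis unfolding eta_quotient_def x_y_def ..
  qed
  have G: "dedekind_eta t / dedekind_eta (of_nat p * t) ^ p =
      dedekind_eta \<tau> / dedekind_eta (of_nat p * \<tau>) ^ p / J ^ n"
    unfolding t_def J_def c by (rule eta_quotient_Gamma1[OF det1 a \<tau> p M])
  have J': "J = of_int c' * (of_nat p * \<tau>) + of_int d"
    by (simp add: J_def c mult_ac)
  have pt: "of_nat p * t = (of_int a * (of_nat p * \<tau>) + of_int (int p * b)) / (of_int c' * (of_nat p * \<tau>) + of_int d)"
    unfolding t_def J' by (simp add: algebra_simps)
  have D: "dedekind_eta (of_nat p * t) ^ 24 = J ^ 12 * dedekind_eta (of_nat p * \<tau>) ^ 24"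
    unfolding pt J' by (rule eta_power24_moebius[OF det2 Im_p[OF \<tau>]])
  \<comment> \<open>The weights add up: \<open>- n * r\<close> from the power of the quotient and
    \<open>12 * e\<close> from the 24th powers.\<close>
  have "2 * (12 * e - int n * r) = 2 * k"
    using e weight p by (simp add: algebra_simps)
  then have k: "12 * e = int n * r + k" by simp
  have "eta_quotient p r s t = J powi (12 * e) / J powi (int n * r) * eta_quotient p r s \<tau>"
    unfolding fe[OF t] fe[OF \<tau>] G D power_int_divide_distrib power_int_mult_distrib power_int_power_left
    by (simp add: field_simps)
  also have "J powi (12 * e) / J powi (int n * r) = J powi k"
    unfolding k using J by (simp add: power_int_add)
  finally have "eta_quotient p r s t = J powi k * eta_quotient p r s \<tau>" .
  then show ?thesis
    unfolding slash_def moebius_act_def abcd[symmetric] J_def[symmetric] t_def[symmetric]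
    using J by (simp add: power_int_minus)
qed

section \<open>Transformation to the cusps\<close>

lemma holomorphic_on_eta_quotient:
  assumes "p > 0"
  shows "eta_quotient p r s holomorphic_on upper_half_plane"
  unfolding eta_quotient_def using assms dedekind_eta_nonzero
  by (intro holomorphic_intros holomorphic_on_dedekind_eta open_upper_half_plane)
     (auto simp: mem_upper_half_plane)

lemma holomorphic_on_slash:
  assumes A: "A \<in> SL2Z" and f: "f holomorphic_on upper_half_plane"
  shows "slash k f A holomorphic_on upper_half_plane"
proof -
  have det: "A $ 1 $ 1 * A $ 2 $ 2 - A $ 1 $ 2 * A $ 2 $ 1 = 1" using A by (simp add: SL2Z_iff)
  have nz: "of_int (A $ 2 $ 1) * \<tau> + of_int (A $ 2 $ 2) \<noteq> 0" if "\<tau> \<in> upper_half_plane" for \<tau>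
    using denom_nonzero[OF det] that by (simp add: mem_upper_half_plane)
  have "moebius_act A holomorphic_on upper_half_plane"
    unfolding moebius_act_def using nz by (intro holomorphic_intros) auto
  moreover have "moebius_act A ` upper_half_plane \<subseteq> upper_half_plane"
    unfolding moebius_act_def using Im_moebius[OF det] by (auto simp: mem_upper_half_plane)
  ultimately have "(f \<circ> moebius_act A) holomorphic_on upper_half_plane"
    using f by (intro holomorphic_on_compose_gen)
  then show ?thesis
    unfolding slash_def o_def using nz by (intro holomorphic_intros) auto
qed

text \<open>The ratio is continuous with values among the finitely many n-th roots of
  \<open>w\<close>, hence constant on a connected set.\<close>

lemma holomorphic_ratio_constant:
  assumes S: "connected S" "S \<noteq> {}" and f: "f holomorphic_on S" and g: "g holomorphic_on S"
    and nz: "\<And>z. z \<in> S \<Longrightarrow> f z \<noteq> 0" "\<And>z. z \<in> S \<Longrightarrow> g z \<noteq> 0"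
    and n: "n > 0" and eq: "\<And>z. z \<in> S \<Longrightarrow> f z ^ n = w * g z ^ n"
  shows "\<exists>C. C \<noteq> 0 \<and> (\<forall>z\<in>S. f z = C * g z)"
proof -
  have "(\<lambda>z. f z / g z) ` S \<subseteq> {x. x ^ n = w}"
    using nz eq by (auto simp: power_divide)
  then have "finite ((\<lambda>z. f z / g z) ` S)"
    using finite_nth_roots[OF n] finite_subset by blast
  moreover have "continuous_on S (\<lambda>z. f z / g z)"
    using nz by (intro continuous_intros holomorphic_on_imp_continuous_on f g) auto
  ultimately have "(\<lambda>z. f z / g z) constant_on S"
    using continuous_finite_range_constant[OF S(1)] by blast
  then obtain C where C: "\<And>z. z \<in> S \<Longrightarrow> f z / g z = C" unfolding constant_on_def by blast
  have "f z = C * g z" if "z \<in> S" for z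
    using C[OF that] nz(2)[OF that] by (simp add: field_simps)
  then show ?thesis using S(2) nz(1) by (metis all_not_in_conv mult_zero_left)
qed

text \<open>Only 24th powers have to be compared: two continuous functions on a connected set whose 24th
  powers are proportional are themselves proportional.\<close>

lemma slash_eta_quotient_proportional:
  fixes A :: "int ^ 2 ^ 2" and r s k :: int and p :: nat
  assumes A: "A \<in> SL2Z" and p: "p > 0" and weight: "r + s = 2 * k"
    and \<sigma>: "\<sigma> holomorphic_on upper_half_plane" "\<And>\<tau>. Im \<tau> > 0 \<Longrightarrow> Im (\<sigma> \<tau>) > 0"
    and \<kappa>: "\<kappa> \<noteq> 0" "\<And>\<tau>. Im \<tau> > 0 \<Longrightarrow> dedekind_eta (of_nat p * moebius_act A \<tau>) ^ 24 =
        \<kappa> * (of_int (A $ 2 $ 1) * \<tau> + of_int (A $ 2 $ 2)) ^ 12 * dedekind_eta (\<sigma> \<tau>) ^ 24"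
  shows "\<exists>C. C \<noteq> 0 \<and> (\<forall>\<tau>\<in>upper_half_plane. slash k (eta_quotient p r s) A \<tau> =
           C * (dedekind_eta \<tau> powi r * dedekind_eta (\<sigma> \<tau>) powi s))"
proof (rule holomorphic_ratio_constant)
  have det: "A $ 1 $ 1 * A $ 2 $ 2 - A $ 1 $ 2 * A $ 2 $ 1 = 1" using A by (simp add: SL2Z_iff)
  have act: "Im (moebius_act A \<tau>) > 0" if "Im \<tau> > 0" for \<tau>
    unfolding moebius_act_def by (rule Im_moebius[OF det that])
  show "connected upper_half_plane" by (rule connected_upper_half_plane)
  show "upper_half_plane \<noteq> {}" using mem_upper_half_plane[of \<i>] by auto
  show "slash k (eta_quotient p r s) A holomorphic_on upper_half_plane"
    by (intro holomorphic_on_slash A holomorphic_on_eta_quotient p)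
  show "(\<lambda>\<tau>. dedekind_eta \<tau> powi r * dedekind_eta (\<sigma> \<tau>) powi s) holomorphic_on upper_half_plane"
    using \<sigma> dedekind_eta_nonzero
    by (intro holomorphic_intros holomorphic_on_dedekind_eta open_upper_half_plane)
       (auto simp: mem_upper_half_plane)
  show "(24::nat) > 0" by simp
  fix \<tau> assume "\<tau> \<in> upper_half_plane"
  then have \<tau>: "Im \<tau> > 0" by (simp add: mem_upper_half_plane)
  define J where "J = of_int (A $ 2 $ 1) * \<tau> + of_int (A $ 2 $ 2)"
  have J: "J \<noteq> 0" unfolding J_def by (rule denom_nonzero[OF det \<tau>])
  show "slash k (eta_quotient p r s) A \<tau> \<noteq> 0"
    unfolding slash_def J_def[symmetric] using J eta_quotient_nonzero[OF act[OF \<tau>] p] by simp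
  show "dedekind_eta \<tau> powi r * dedekind_eta (\<sigma> \<tau>) powi s \<noteq> 0"
    using dedekind_eta_nonzero[OF \<tau>] dedekind_eta_nonzero[OF \<sigma>(2)[OF \<tau>]] by simp
  have swap: "(x powi i) ^ 24 = (x ^ 24) powi i" for x :: complex and i :: int
    by (metis power_int_of_nat power_int_mult mult.commute)
  have D: "dedekind_eta (moebius_act A \<tau>) ^ 24 = J ^ 12 * dedekind_eta \<tau> ^ 24"
    unfolding moebius_act_def J_def by (rule eta_power24_moebius[OF det \<tau>])
  \<comment> \<open>All powers of \<open>J\<close> cancel because 12(r + s) = 24k.\<close>
  have "(J ^ 24) powi (- k) * (J ^ 12) powi r * (J ^ 12) powi s = J powi (24 * (- k) + 12 * r + 12 * s)"
    unfolding power_int_power_left by (simp only: power_int_add J simp_thms of_nat_numeral)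
  also have "24 * (- k) + 12 * r + 12 * s = 0" using weight by simp
  finally have J0: "(J ^ 24) powi (- k) * (J ^ 12) powi r * (J ^ 12) powi s = 1" by simp
  have "slash k (eta_quotient p r s) A \<tau> ^ 24 =
     (J ^ 24) powi (- k) * (dedekind_eta (moebius_act A \<tau>) ^ 24) powi r *
       (dedekind_eta (of_nat p * moebius_act A \<tau>) ^ 24) powi s"
    unfolding slash_def eta_quotient_def J_def[symmetric] by (simp only: power_mult_distrib swap mult.assoc)
  also have "\<dots> = ((J ^ 24) powi (- k) * (J ^ 12) powi r * (J ^ 12) powi s) * \<kappa> powi s *
      ((dedekind_eta \<tau> ^ 24) powi r * (dedekind_eta (\<sigma> \<tau>) ^ 24) powi s)"
    unfolding D \<kappa>(2)[OF \<tau>] J_def[symmetric] power_int_mult_distrib by (simp only: mult_ac)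
  also have "\<dots> = \<kappa> powi s * (dedekind_eta \<tau> powi r * dedekind_eta (\<sigma> \<tau>) powi s) ^ 24"
    unfolding J0 by (simp only: power_mult_distrib swap mult_1_left)
  finally show "slash k (eta_quotient p r s) A \<tau> ^ 24 =
      \<kappa> powi s * (dedekind_eta \<tau> powi r * dedekind_eta (\<sigma> \<tau>) powi s) ^ 24" .
qed

text \<open>Cusps equivalent to infinity: conjugation by diag(p, 1) keeps the matrix integral, so
  the second eta keeps the argument \<open>p * \<tau>\<close>.\<close>

lemma slash_eta_quotient_dvd:
  fixes A :: "int ^ 2 ^ 2" and r s k :: int and p :: nat
  assumes A: "A \<in> SL2Z" and p: "p > 0" and weight: "r + s = 2 * k" and dvd: "int p dvd A $ 2 $ 1"
  shows "\<exists>C. C \<noteq> 0 \<and> (\<forall>\<tau>\<in>upper_half_plane. slash k (eta_quotient p r s) A \<tau> =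
           C * (dedekind_eta \<tau> powi r * dedekind_eta (of_nat p * \<tau>) powi s))"
proof (rule slash_eta_quotient_proportional[OF A p weight, where \<kappa> = 1])
  show "Im (of_nat p * \<tau>) > 0" if "Im \<tau> > 0" for \<tau> using that p by simp
  obtain c where c: "A $ 2 $ 1 = int p * c" using dvd by blast
  have det: "A $ 1 $ 1 * A $ 2 $ 2 - (int p * A $ 1 $ 2) * c = 1" using A by (simp add: SL2Z_iff c mult_ac)
  fix \<tau> :: complex assume \<tau>: "Im \<tau> > 0"
  have \<tau>': "Im (of_nat p * \<tau>) > 0" using \<tau> p by simp
  have "of_nat p * moebius_act A \<tau> = (of_int (A $ 1 $ 1) * (of_nat p * \<tau>) + of_int (int p * A $ 1 $ 2)) /
     (of_int c * (of_nat p * \<tau>) + of_int (A $ 2 $ 2))"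
    unfolding moebius_act_def c by (simp add: algebra_simps)
  then show "dedekind_eta (of_nat p * moebius_act A \<tau>) ^ 24 =
      1 * (of_int (A $ 2 $ 1) * \<tau> + of_int (A $ 2 $ 2)) ^ 12 * dedekind_eta (of_nat p * \<tau>) ^ 24"
    using eta_power24_moebius[OF det \<tau>'] by (simp add: c mult_ac)
qed (auto intro!: holomorphic_intros)

text \<open>Cusps equivalent to 0: diag(p, 1)A factors as (pa, b - a\<beta>; c, w) times (1,
  \<beta>; 0, p), where the first factor has determinant 1. Its denominator at \<open>z\<close> is
  J/p, whence the constant p^-12.\<close>

lemma slash_eta_quotient_not_dvd:
  fixes A :: "int ^ 2 ^ 2" and r s k :: int and p :: nat
  assumes A: "A \<in> SL2Z" and p: "prime p" and weight: "r + s = 2 * k" and dvd: "\<not> int p dvd A $ 2 $ 1"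
  shows "\<exists>(\<beta>::int) C. C \<noteq> 0 \<and> (\<forall>\<tau>\<in>upper_half_plane. slash k (eta_quotient p r s) A \<tau> =
           C * (dedekind_eta \<tau> powi r * dedekind_eta ((\<tau> + of_int \<beta>) / of_nat p) powi s))"
proof -
  define a b c d where "a = A $ 1 $ 1" "b = A $ 1 $ 2" "c = A $ 2 $ 1" "d = A $ 2 $ 2"
  note abcd = this
  have det: "a * d - b * c = 1" using A by (simp add: SL2Z_iff abcd)
  have p0: "p > 0" using p prime_gt_0_nat by blast
  have "coprime (int p) c" using p dvd by (simp add: abcd prime_imp_coprime)
  then obtain x where "[c * x = 1] (mod int p)"
    using cong_solve_coprime_int coprime_commute by blast
  \<comment> \<open>As \<open>x\<close> inverts \<open>c\<close> modulo \<open>p\<close>, the choice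
    \<beta> = x d solves c \<beta> = d modulo \<open>p\<close>.\<close>
  then have "[c * x * d = 1 * d] (mod int p)" by (rule cong_scalar_right)
  then have "int p dvd d - c * (x * d)" by (simp add: cong_iff_dvd_diff dvd_diff_commute mult.assoc)
  then obtain \<beta> w where w: "d - c * \<beta> = int p * w" by blast
  have "\<exists>C. C \<noteq> 0 \<and> (\<forall>\<tau>\<in>upper_half_plane. slash k (eta_quotient p r s) A \<tau> =
           C * (dedekind_eta \<tau> powi r * dedekind_eta ((\<tau> + of_int \<beta>) / of_nat p) powi s))"
  proof (rule slash_eta_quotient_proportional[OF A p0 weight, where \<kappa> = "1 / of_nat p ^ 12"])
    show "(\<lambda>\<tau>. (\<tau> + of_int \<beta>) / of_nat p) holomorphic_on upper_half_plane"
      using p0 by (auto intro!: holomorphic_intros)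
    show Im_pos: "Im ((\<tau> + of_int \<beta>) / of_nat p) > 0" if "Im \<tau> > 0" for \<tau> using that p0 by simp
    show "1 / of_nat p ^ 12 \<noteq> (0 :: complex)" using p0 by simp
    have "int p * a * w - (b - a * \<beta>) * c = a * (int p * w) - (b - a * \<beta>) * c" by simp
    also have "\<dots> = 1" unfolding w[symmetric] using det by (simp add: algebra_simps)
    finally have det': "int p * a * w - (b - a * \<beta>) * c = 1" .
    have wc: "of_nat p * of_int w = of_int d - of_int c * (of_int \<beta> :: complex)"
      by (metis of_int_diff of_int_mult of_int_of_nat_eq w)
    fix \<tau> :: complex assume \<tau>: "Im \<tau> > 0"
    define z where "z = (\<tau> + of_int \<beta>) / of_nat p"
    define J where "J = of_int c * \<tau> + of_int d"
    have pz: "of_nat p * z = \<tau> + of_int \<beta>" using p0 by (simp add: z_def)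
    have "of_nat p * (of_int c * z + of_int w) = of_int c * (of_nat p * z) + of_nat p * of_int w"
      by (simp add: algebra_simps)
    also have "\<dots> = J" unfolding pz wc J_def by (simp add: algebra_simps)
    finally have den: "of_int c * z + of_int w = J / of_nat p"
      using p0 by (simp add: field_simps)
    have num: "of_int (int p * a) * z + of_int (b - a * \<beta>) = of_int a * \<tau> + of_int b"
    proof -
      have "of_int (int p * a) * z + of_int (b - a * \<beta>) = of_int a * (of_nat p * z) + of_int (b - a * \<beta>)"
        by (simp add: mult_ac)
      then show ?thesis unfolding pz by (simp add: algebra_simps)
    qed
    have "of_nat p * moebius_act A \<tau> = (of_int (int p * a) * z + of_int (b - a * \<beta>)) / (of_int c * z + of_int w)"
      unfolding moebius_act_def abcd[symmetric] J_def[symmetric] num den by simp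
    then have "dedekind_eta (of_nat p * moebius_act A \<tau>) ^ 24 = (of_int c * z + of_int w) ^ 12 * dedekind_eta z ^ 24"
      using eta_power24_moebius[OF det' Im_pos[OF \<tau>]] by (simp add: z_def)
    then show "dedekind_eta (of_nat p * moebius_act A \<tau>) ^ 24 =
      1 / of_nat p ^ 12 * (of_int (A $ 2 $ 1) * \<tau> + of_int (A $ 2 $ 2)) ^ 12 * dedekind_eta ((\<tau> + of_int \<beta>) / of_nat p) ^ 24"
      unfolding den z_def[symmetric] abcd[symmetric] J_def[symmetric] by (simp add: power_divide)
  qed
  then show ?thesis by blast
qed

section \<open>Expansions and orders at the cusps\<close>

text \<open>The parameter is q^(1/p), as in \<open>holomorphic_at_infinity p\<close>. The order (r +
  ps)/24 in q therefore appears multiplied by \<open>p\<close>.\<close>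

lemma eta_quotient_expansion_infinity:
  fixes r s e :: int and p :: nat
  assumes p: "p > 0" and e: "r + int p * s = 24 * e"
  defines "P \<equiv> \<lambda>y. qpoch y y"
  shows "dedekind_eta \<tau> powi r * dedekind_eta (of_nat p * \<tau>) powi s =
    expi (2 * \<tau> / of_nat p) powi (int p * e) *
      (P (expi (2 * \<tau> / of_nat p) ^ p) powi r * P (expi (2 * \<tau> / of_nat p) ^ (p * p)) powi s)"
proof -
  define x where "x = expi (2 * \<tau> / of_nat p)"
  have x1: "x ^ p = expi (2 * \<tau>)" and x2: "x ^ (p * p) = expi (2 * (of_nat p * \<tau>))"
    unfolding x_def expi_mult_of_nat[symmetric] using p by (simp_all add: mult_ac)
  have ec: "of_int r + of_nat p * of_int s = (24 * of_int e :: complex)"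
    using arg_cong[OF e, of "of_int :: int \<Rightarrow> complex"] by simp
  have "of_int r * (\<tau> / 12) + of_int s * (of_nat p * \<tau> / 12) = (of_int r + of_nat p * of_int s) * \<tau> / 12"
    by (simp add: field_simps)
  also have "\<dots> = of_int (int p * e) * (2 * \<tau> / of_nat p)"
    unfolding ec using p by simp
  finally have eq: "expi (\<tau> / 12) powi r * expi (of_nat p * \<tau> / 12) powi s = x powi (int p * e)"
    unfolding x_def expi_mult_of_int[symmetric] expi_add[symmetric] by simp
  show ?thesis
    unfolding x_def[symmetric] x1 x2 dedekind_eta_eq_qpoch P_def power_int_mult_distrib
      mult.assoc[symmetric] eq[symmetric]
    by (simp only: mult_ac)
qed

text \<open>In the parameter q^(1/p) the order is \<open>e\<close> itself; the shift by
  \<open>\<beta>\<close> only brings in roots of unity.\<close>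

lemma eta_quotient_expansion_zero:
  fixes r s e \<beta> :: int and p :: nat
  assumes p: "p > 0" and e: "int p * r + s = 24 * e"
  defines "P \<equiv> \<lambda>y. qpoch y y"
  shows "dedekind_eta \<tau> powi r * dedekind_eta ((\<tau> + of_int \<beta>) / of_nat p) powi s =
    expi (of_int (s * \<beta>) / (12 * of_nat p)) * (expi (2 * \<tau> / of_nat p) powi e *
      (P (expi (2 * \<tau> / of_nat p) ^ p) powi r *
       P (expi (2 * of_int \<beta> / of_nat p) * expi (2 * \<tau> / of_nat p)) powi s))"
proof -
  define x where "x = expi (2 * \<tau> / of_nat p)"
  have x1: "x ^ p = expi (2 * \<tau>)"
    unfolding x_def expi_mult_of_nat[symmetric] using p by (simp add: mult_ac)
  have x2: "expi (2 * of_int \<beta> / of_nat p) * x = expi (2 * ((\<tau> + of_int \<beta>) / of_nat p))"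
    unfolding x_def expi_add[symmetric] by (simp add: add_divide_distrib add.commute ring_distribs)
  have ec: "of_nat p * of_int r + of_int s = (24 * of_int e :: complex)"
    using arg_cong[OF e, of "of_int :: int \<Rightarrow> complex"] by simp
  have "of_int r * (\<tau> / 12) + of_int s * ((\<tau> + of_int \<beta>) / of_nat p / 12) =
      of_int (s * \<beta>) / (12 * of_nat p) + (of_nat p * of_int r + of_int s) * \<tau> / (12 * of_nat p)"
    using p by (simp add: field_simps)
  also have "\<dots> = of_int (s * \<beta>) / (12 * of_nat p) + of_int e * (2 * \<tau> / of_nat p)"
    unfolding ec using p by simp
  finally have eq: "expi (\<tau> / 12) powi r * expi ((\<tau> + of_int \<beta>) / of_nat p / 12) powi s =
      expi (of_int (s * \<beta>) / (12 * of_nat p)) * x powi e"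
    unfolding x_def expi_mult_of_int[symmetric] expi_add[symmetric] by simp
  show ?thesis
    unfolding x_def[symmetric] x1 x2 dedekind_eta_eq_qpoch P_def power_int_mult_distrib
      mult.assoc[symmetric] eq[symmetric]
    by (simp only: mult_ac)
qed

text \<open>For \<open>e < 0\<close> an extension g would satisfy g(x) x^(-e) = C u(x); letting x
  tend to 0 gives 0 on the left and a nonzero value on the right.\<close>

lemma holomorphic_at_infinity_iff_order_nonneg:
  fixes e :: int
  assumes N: "N > 0" and u: "u holomorphic_on ball 0 1" "u 0 \<noteq> 0" and C: "C \<noteq> 0"
    and F: "\<And>\<tau>. Im \<tau> > 0 \<Longrightarrow> F \<tau> = C * (expi (2 * \<tau> / of_nat N) powi e * u (expi (2 * \<tau> / of_nat N)))"
  shows "holomorphic_at_infinity N F \<longleftrightarrow> e \<ge> 0"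
proof -
  have x: "exp (2 * of_real pi * \<i> * \<tau> / of_nat N) = expi (2 * \<tau> / of_nat N)" for \<tau>
    by (simp add: expi_def mult_ac)
  show ?thesis
  proof
    assume "e \<ge> 0"
    then obtain m where m: "e = int m" by (metis nonneg_int_cases)
    have "(\<lambda>x. C * (x ^ m * u x)) holomorphic_on ball 0 1"
      by (intro holomorphic_intros u)
    then show "holomorphic_at_infinity N F"
      unfolding holomorphic_at_infinity_def x
      by (intro exI[of _ "\<lambda>x. C * (x ^ m * u x)"]) (auto simp: F m mem_upper_half_plane)
  next
    assume "holomorphic_at_infinity N F"
    then obtain g where g: "g holomorphic_on ball 0 1"
        "\<And>\<tau>. Im \<tau> > 0 \<Longrightarrow> F \<tau> = g (expi (2 * \<tau> / of_nat N))"
      unfolding holomorphic_at_infinity_def x by (auto simp: mem_upper_half_plane)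
    show "e \<ge> 0"
    proof (rule ccontr)
      assume "\<not> e \<ge> 0"
      then obtain m where m: "e = - int m" "m > 0" by (metis not_le neg_int_cases of_nat_0_less_iff)
      \<comment> \<open>The points \<tau> = (j + 1) i correspond to the powers of \<open>y\<close>,
        a null sequence of nonzero points in the disc.\<close>
      define y where "y = expi (2 * \<i> / of_nat N)"
      define X where "X = (\<lambda>j. y ^ Suc j)"
      have "norm y < 1" unfolding y_def using N by (intro norm_expi_less_1) simp
      then have X: "X \<longlonglongrightarrow> 0" unfolding X_def by (intro LIMSEQ_Suc LIMSEQ_power_zero)
      have cont: "isCont h 0" if "h holomorphic_on ball 0 1" for h :: "complex \<Rightarrow> complex"
        using holomorphic_on_imp_continuous_on[OF that] by (simp add: continuous_on_eq_continuous_at)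
      have eq: "g (X j) * X j ^ m = C * u (X j)" for j
      proof -
        define \<tau> where "\<tau> = of_nat (Suc j) * \<i>"
        have \<tau>: "Im \<tau> > 0" by (simp add: \<tau>_def)
        have Xj: "X j = expi (2 * \<tau> / of_nat N)"
          unfolding X_def y_def \<tau>_def expi_mult_of_nat[symmetric] by (simp add: mult_ac)
        have "g (X j) = C * (X j powi e * u (X j))"
          using F[OF \<tau>] g(2)[OF \<tau>] unfolding Xj by simp
        moreover have "X j powi e * X j ^ m = 1"
          unfolding m by (simp add: power_int_minus Xj)
        ultimately show ?thesis by (simp add: mult_ac)
      qed
      have "(\<lambda>j. g (X j) * X j ^ m) \<longlonglongrightarrow> g 0 * 0 ^ m"
        by (intro tendsto_mult tendsto_power X isCont_tendsto_compose[OF cont[OF g(1)]])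
      moreover have "(\<lambda>j. g (X j) * X j ^ m) \<longlonglongrightarrow> C * u 0"
        unfolding eq by (intro tendsto_mult tendsto_const X isCont_tendsto_compose[OF cont[OF u(1)]])
      ultimately have "g 0 * 0 ^ m = C * u 0" by (rule LIMSEQ_unique)
      then show False using m(2) C u(2) by (simp add: zero_power)
    qed
  qed
qed

lemma holomorphic_at_infinity_slash_eta_quotient:
  fixes A :: "int ^ 2 ^ 2" and r s k :: int and p :: nat
  assumes A: "A \<in> SL2Z" and p: "prime p" and weight: "r + s = 2 * k"
    and dvd: "24 dvd r + int p * s" "24 dvd int p * r + s"
  shows "holomorphic_at_infinity p (slash k (eta_quotient p r s) A) \<longleftrightarrow>
    (if int p dvd A $ 2 $ 1 then r + int p * s \<ge> 0 else int p * r + s \<ge> 0)"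
proof -
  have p0: "p > 0" using p prime_gt_0_nat by blast
  define P where "P = (\<lambda>y. qpoch y y)"
  have P0: "P 0 = 1" by (simp add: P_def)
  have P: "(\<lambda>z. P (h z) powi i) holomorphic_on ball 0 1"
    if h: "h holomorphic_on ball 0 1" and lt: "\<And>z. z \<in> ball 0 1 \<Longrightarrow> norm (h z) < 1"
    for h :: "complex \<Rightarrow> complex" and i :: int
  proof -
    have "(\<lambda>z. P (h z)) holomorphic_on ball 0 1"
      unfolding P_def by (intro holomorphic_on_qpoch open_ball h lt)
    moreover have "P (h z) \<noteq> 0" if "z \<in> ball 0 1" for z
      unfolding P_def by (intro qpoch_nonzero lt that)
    ultimately show ?thesis by (intro holomorphic_on_power_int) auto
  qed
  have pow: "norm (z ^ l) < 1" if "z \<in> ball 0 1" "l > 0" for z :: complex and l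
    using that by (simp add: norm_power power_less_one_iff)
  show ?thesis
  proof (cases "int p dvd A $ 2 $ 1")
    case True
    obtain e where e: "r + int p * s = 24 * e" using dvd(1) by blast
    obtain C where C: "C \<noteq> 0" "\<And>\<tau>. \<tau> \<in> upper_half_plane \<Longrightarrow> slash k (eta_quotient p r s) A \<tau> =
           C * (dedekind_eta \<tau> powi r * dedekind_eta (of_nat p * \<tau>) powi s)"
      using slash_eta_quotient_dvd[OF A p0 weight True] by blast
    define u where "u = (\<lambda>z. P (z ^ p) powi r * P (z ^ (p * p)) powi s)"
    have "u holomorphic_on ball 0 1"
      unfolding u_def using p0 pow by (intro holomorphic_on_mult P) (auto intro!: holomorphic_intros)
    moreover have "u 0 \<noteq> 0" using p0 by (simp add: u_def P0 power_0_left)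
    ultimately have "holomorphic_at_infinity p (slash k (eta_quotient p r s) A) \<longleftrightarrow> int p * e \<ge> 0"
      using C by (intro holomorphic_at_infinity_iff_order_nonneg[OF p0])
        (auto simp: mem_upper_half_plane u_def P_def eta_quotient_expansion_infinity[OF p0 e])
    also have "\<dots> \<longleftrightarrow> r + int p * s \<ge> 0" using p0 e by (simp add: zero_le_mult_iff)
    finally show ?thesis using True by simp
  next
    case False
    obtain e where e: "int p * r + s = 24 * e" using dvd(2) by blast
    obtain C and \<beta> :: int where C: "C \<noteq> 0" "\<And>\<tau>. \<tau> \<in> upper_half_plane \<Longrightarrow> slash k (eta_quotient p r s) A \<tau> =
           C * (dedekind_eta \<tau> powi r * dedekind_eta ((\<tau> + of_int \<beta>) / of_nat p) powi s)"
      using slash_eta_quotient_not_dvd[OF A p weight False] by blast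
    define \<zeta> where "\<zeta> = expi (2 * of_int \<beta> / of_nat p)"
    have \<zeta>: "norm \<zeta> = 1" by (simp add: \<zeta>_def norm_expi)
    define u where "u = (\<lambda>z. P (z ^ p) powi r * P (\<zeta> * z) powi s)"
    have "u holomorphic_on ball 0 1"
      unfolding u_def using p0 pow \<zeta>
      by (intro holomorphic_on_mult P) (auto simp: norm_mult intro!: holomorphic_intros)
    moreover have "u 0 \<noteq> 0" using p0 by (simp add: u_def P0 power_0_left)
    ultimately have "holomorphic_at_infinity p (slash k (eta_quotient p r s) A) \<longleftrightarrow> e \<ge> 0"
      using C by (intro holomorphic_at_infinity_iff_order_nonneg[OF p0, of u "C * expi (of_int (s * \<beta>) / (12 * of_nat p))"])
        (auto simp: mem_upper_half_plane u_def P_def \<zeta>_def eta_quotient_expansion_zero[OF p0 e])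
    also have "\<dots> \<longleftrightarrow> int p * r + s \<ge> 0" using e by simp
    finally show ?thesis using False by simp
  qed
qed

section \<open>Admissible exponents\<close>

lemma prime_ge_5_half:
  fixes p :: nat
  assumes "prime p" "p \<ge> 5"
  obtains n M where "p = 2 * n + 1" "n * (n + 1) = 6 * M"
proof -
  have "odd p" using assms prime_odd_nat by force
  then obtain n where n: "p = 2 * n + 1" by (elim oddE)
  have "\<not> 3 dvd p" using assms primes_dvd_imp_eq[of 3 p] by auto
  \<comment> \<open>If \<open>n\<close> were 1 modulo 3, then 3 would divide p = 2n + 1.\<close>
  then have "\<not> n mod 3 = 1" unfolding n by presburger
  then have "n mod 3 = 0 \<or> (n + 1) mod 3 = 0" by presburger
  then have "3 dvd n * (n + 1)" by (metis dvd_eq_mod_eq_0 dvd_mult dvd_mult2)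
  moreover have "2 dvd n * (n + 1)" by simp
  moreover have "2 dvd x \<Longrightarrow> 3 dvd x \<Longrightarrow> 6 dvd x" for x :: nat by presburger
  ultimately obtain M where "n * (n + 1) = 6 * M" by (metis dvdE)
  with n show ?thesis by (rule that)
qed

text \<open>Since p^2 is 1 modulo 24, multiplication by \<open>p\<close> interchanges the two
  expressions modulo 24.\<close>

lemma dvd_24_swap:
  fixes r s :: int
  assumes p: "prime p" "p \<ge> 5"
  shows "24 dvd r + int p * s \<longleftrightarrow> 24 dvd int p * r + s"
proof -
  obtain n M where n: "p = 2 * n + 1" and M: "n * (n + 1) = 6 * M"
    using prime_ge_5_half[OF p] .
  have "int n * (int n + 1) = 6 * int M"
    using arg_cong[OF M, of int] by (simp add: algebra_simps)
  then have pp: "int p * int p = 1 + 24 * int M"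
    unfolding n by (simp add: algebra_simps)
  have "int p * (r + int p * s) = int p * r + (int p * int p) * s" by (simp add: algebra_simps)
  then have 1: "int p * (r + int p * s) = (int p * r + s) + 24 * (int M * s)"
    unfolding pp by (simp add: algebra_simps)
  have "int p * (int p * r + s) = (int p * int p) * r + int p * s" by (simp add: algebra_simps)
  then have 2: "int p * (int p * r + s) = (r + int p * s) + 24 * (int M * r)"
    unfolding pp by (simp add: algebra_simps)
  show ?thesis
    using 1 2 by (metis dvd_add_left_iff dvd_mult dvd_triv_left)
qed

section \<open>Necessary and sufficient conditions on the exponents\<close>

lemma eta_quotient_add_1:
  "eta_quotient p r s (\<tau> + 1) = expi (of_int (r + int p * s) / 12) * eta_quotient p r s \<tau>"
proof -
  have 1: "dedekind_eta (\<tau> + 1) = expi (1 / 12) * dedekind_eta \<tau>"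
    using dedekind_eta_add_int[of \<tau> 1] by simp
  have 2: "dedekind_eta (of_nat p * (\<tau> + 1)) = expi (of_nat p / 12) * dedekind_eta (of_nat p * \<tau>)"
    using dedekind_eta_add_int[of "of_nat p * \<tau>" "int p"] by (simp add: ring_distribs)
  have e: "of_int r * (1 / 12) + of_int s * (of_nat p / 12) = of_int (r + int p * s) / (12 :: complex)"
    by (simp add: field_simps)
  show ?thesis
    unfolding eta_quotient_def 1 2 power_int_mult_distrib expi_mult_of_int[symmetric] e[symmetric] expi_add
    by (simp only: mult_ac)
qed

text \<open>Invariance under a single matrix is tested at the point i. The 24th power removes roots
  of unity and leaves J^(24k) = J^(12(r + s)).\<close>

lemma modular_eta_quotient_weight:
  fixes r s k :: int
  assumes p: "p > 0" and f: "eta_quotient p r s \<in> modular_forms_Gamma1 k p"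
  shows "r + s = 2 * k"
proof -
  define A :: "int ^ 2 ^ 2" where "A = vector [vector [1, 0], vector [int p, 1]]"
  have A: "A $ 1 $ 1 = 1" "A $ 1 $ 2 = 0" "A $ 2 $ 1 = int p" "A $ 2 $ 2 = 1"
    by (simp_all add: A_def vector_2)
  have "A \<in> Gamma1 p"
    unfolding Gamma1_def SL2Z_iff mem_Collect_eq A by (simp add: cong_0_iff)
  moreover have Im_i: "Im \<i> > 0" by simp
  ultimately have "slash k (eta_quotient p r s) A \<i> = eta_quotient p r s \<i>"
    using f unfolding modular_forms_Gamma1_def by (simp add: mem_upper_half_plane)
  define J :: complex where "J = of_nat p * \<i> + 1"
  have J: "J \<noteq> 0" "norm J > 1"
  proof -
    have "norm J ^ 2 = 1 + real p ^ 2" by (simp add: J_def cmod_power2)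
    also have "\<dots> > 1 ^ 2" using p by simp
    finally show "norm J > 1" by (rule power2_less_imp_less) simp
    then show "J \<noteq> 0" by auto
  qed
  define t where "t = \<i> / J"
  have "J powi (- k) * eta_quotient p r s t = eta_quotient p r s \<i>"
    using \<open>slash k (eta_quotient p r s) A \<i> = eta_quotient p r s \<i>\<close>
    unfolding slash_def moebius_act_def A t_def J_def by simp
  then have ft: "eta_quotient p r s t = J powi k * eta_quotient p r s \<i>"
    using J by (simp add: power_int_minus field_simps)
  \<comment> \<open>The point \<open>t\<close> is the image of i under (1, 0; p, 1), and
    \<open>p * t\<close> is the image of p i under (1, 0; 1, 1); both have the denominator
    \<open>J\<close>.\<close>
  have D1: "dedekind_eta t ^ 24 = J ^ 12 * dedekind_eta \<i> ^ 24"
    using eta_power24_moebius[of 1 1 0 "int p" \<i>] by (simp add: t_def J_def)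
  have D2: "dedekind_eta (of_nat p * t) ^ 24 = J ^ 12 * dedekind_eta (of_nat p * \<i>) ^ 24"
    using eta_power24_moebius[of 1 1 0 1 "of_nat p * \<i>"] p by (simp add: t_def J_def)
  have swap: "(x powi i) ^ 24 = (x ^ 24) powi i" for x :: complex and i :: int
    by (metis power_int_of_nat power_int_mult mult.commute)
  have "eta_quotient p r s t ^ 24 = (J ^ 12) powi r * (J ^ 12) powi s * eta_quotient p r s \<i> ^ 24"
    unfolding eta_quotient_def power_mult_distrib swap D1 D2 power_int_mult_distrib by (simp only: mult_ac)
  also have "(J ^ 12) powi r * (J ^ 12) powi s = J powi (12 * (r + s))"
    unfolding power_int_power_left using J by (simp add: power_int_add ring_distribs)
  finally have "(J ^ 24) powi k * eta_quotient p r s \<i> ^ 24 = J powi (12 * (r + s)) * eta_quotient p r s \<i> ^ 24"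
    unfolding ft power_mult_distrib swap .
  then have "J powi (24 * k) = J powi (12 * (r + s))"
    using eta_quotient_nonzero[OF Im_i p, of r s] by (simp add: power_int_power_left)
  \<comment> \<open>Passing to absolute values allows the exponents to be compared, because
    \<open>norm J > 1\<close>.\<close>
  then have "norm J powi (24 * k) = norm J powi (12 * (r + s))"
    by (metis norm_power_int)
  then have "norm J powr real_of_int (24 * k) = norm J powr real_of_int (12 * (r + s))"
    using J by (subst (1 2) powr_real_of_int') auto
  then have "real_of_int (24 * k) = real_of_int (12 * (r + s))"
    using J(2) by (subst (asm) powr_inj) auto
  then have "24 * k = 12 * (r + s)" by (simp only: of_int_eq_iff)
  then show ?thesis by simp
qed

text \<open>For necessity, the weight comes first; invariance under the translation \<open>T\<close>
  forces 24 to divide r + ps, and the orders are read off at infinity with \<open>T\<close> and at 0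
  with \<open>S\<close>.\<close>

theorem eta_quotient_modular_iff:
  fixes p :: nat and r s k :: int
  assumes p: "prime p" "p \<ge> 5"
  shows "eta_quotient p r s \<in> modular_forms_Gamma1 k p \<longleftrightarrow>
    r + s = 2 * k \<and> 24 dvd int p * r + s \<and> r + int p * s \<ge> 0 \<and> int p * r + s \<ge> 0"
proof
  obtain n M where n: "p = 2 * n + 1" and M: "n * (n + 1) = 6 * M"
    using prime_ge_5_half[OF p] .
  have p0: "p > 0" using p by simp
  assume *: "r + s = 2 * k \<and> 24 dvd int p * r + s \<and> r + int p * s \<ge> 0 \<and> int p * r + s \<ge> 0"
  then have "24 dvd r + int p * s" using dvd_24_swap[OF p] by blast
  with * show "eta_quotient p r s \<in> modular_forms_Gamma1 k p"
    unfolding modular_forms_Gamma1_def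
    by (auto simp: mem_upper_half_plane holomorphic_on_eta_quotient[OF p0]
        holomorphic_at_infinity_slash_eta_quotient[OF _ p(1)] eta_quotient_slash_Gamma1[OF _ _ n M])
next
  have p0: "p > 0" using p by simp
  assume f: "eta_quotient p r s \<in> modular_forms_Gamma1 k p"
  have weight: "r + s = 2 * k" by (rule modular_eta_quotient_weight[OF p0 f])
  define T :: "int ^ 2 ^ 2" where "T = vector [vector [1, 1], vector [0, 1]]"
  have T: "T $ 1 $ 1 = 1" "T $ 1 $ 2 = 1" "T $ 2 $ 1 = 0" "T $ 2 $ 2 = 1"
    by (simp_all add: T_def vector_2)
  have "T \<in> Gamma1 p" unfolding Gamma1_def SL2Z_iff mem_Collect_eq T by simp
  then have "slash k (eta_quotient p r s) T \<i> = eta_quotient p r s \<i>"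
    using f unfolding modular_forms_Gamma1_def by (simp add: mem_upper_half_plane)
  then have "eta_quotient p r s (\<i> + 1) = eta_quotient p r s \<i>"
    unfolding slash_def moebius_act_def T by simp
  then have "expi (of_int (r + int p * s) / 12) = 1"
    unfolding eta_quotient_add_1 using eta_quotient_nonzero[of \<i> p r s] p0 by simp
  then obtain l :: int where "of_int (r + int p * s) / 12 = (2 * of_int l :: complex)"
    unfolding expi_eq_1_iff by blast
  then have "of_int (r + int p * s) = (of_int (24 * l) :: complex)" by (simp add: field_simps)
  then have "r + int p * s = 24 * l" by (simp only: of_int_eq_iff)
  then have dvd1: "24 dvd r + int p * s" by simp
  then have dvd2: "24 dvd int p * r + s" using dvd_24_swap[OF p] by blast
  define S :: "int ^ 2 ^ 2" where "S = vector [vector [0, -1], vector [1, 0]]"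
  have S: "S $ 1 $ 1 = 0" "S $ 1 $ 2 = -1" "S $ 2 $ 1 = 1" "S $ 2 $ 2 = 0"
    by (simp_all add: S_def vector_2)
  have mem: "T \<in> SL2Z" "S \<in> SL2Z" unfolding SL2Z_iff T S by simp_all
  then have "holomorphic_at_infinity p (slash k (eta_quotient p r s) T)"
    "holomorphic_at_infinity p (slash k (eta_quotient p r s) S)"
    using f unfolding modular_forms_Gamma1_def by blast+
  then have "r + int p * s \<ge> 0" "int p * r + s \<ge> 0"
    using holomorphic_at_infinity_slash_eta_quotient[OF mem(1) p(1) weight dvd1 dvd2]
      holomorphic_at_infinity_slash_eta_quotient[OF mem(2) p(1) weight dvd1 dvd2] p
    unfolding T S by auto
  with weight dvd2 show "r + s = 2 * k \<and> 24 dvd int p * r + s \<and> r + int p * s \<ge> 0 \<and> int p * r + s \<ge> 0"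
    by blast
qed

section \<open>Arithmetic modulo 24\<close>

text \<open>Modulo g = 2h, a common divisor of p - 1 and 24, the number pr + s becomes r + s = 2k,
  so h divides k. In the excluded case the orders confine r to 0..4, while divisibility by 24 makes
  r equal to 5 modulo 6.\<close>

lemma eta_exponents_imp_conditions:
  fixes p h :: nat and r s k :: int
  assumes p: "p > 1" "odd p" and h: "h = gcd (p - 1) 24 div 2"
    and weight: "r + s = 2 * k" and dvd: "24 dvd int p * r + s"
    and nonneg: "r + int p * s \<ge> 0" "int p * r + s \<ge> 0"
  shows "int h dvd k \<and> \<not> (p \<noteq> 5 \<and> [p = 5] (mod 24) \<and> k = 2)"
proof
  define g where "g = gcd (p - 1) 24"
  have "even g" using p by (auto simp: g_def)
  moreover have "h = g div 2" unfolding g_def by (rule h)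
  ultimately have g2: "int g = 2 * int h" by auto
  have "int g dvd int (p - 1)" "int g dvd 24"
    unfolding g_def by (metis gcd_dvd1 int_dvd_int_iff, metis gcd_dvd2 int_dvd_int_iff of_nat_numeral)
  then have "int g dvd (int p * r + s) - int (p - 1) * r"
    using dvd by (meson dvd_diff dvd_mult2 dvd_trans)
  also have "(int p * r + s) - int (p - 1) * r = 2 * k"
    using p weight by (simp add: of_nat_diff algebra_simps)
  finally show "int h dvd k" unfolding g2 by simp
  show "\<not> (p \<noteq> 5 \<and> [p = 5] (mod 24) \<and> k = 2)"
  proof
    assume *: "p \<noteq> 5 \<and> [p = 5] (mod 24) \<and> k = 2"
    then have "p mod 24 = 5" by (simp add: cong_def)
    moreover have "p = 24 * (p div 24) + p mod 24" by simp
    ultimately obtain t where t: "p = 24 * t + 5" by metis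
    with * have t1: "t \<ge> 1" by (cases t) auto
    have s: "s = 4 - r" using weight * by simp
    have "int p * r + s = 24 * (int t * r) + (4 * r + 4)" unfolding s t by (simp add: algebra_simps)
    then have "24 dvd 4 * r + 4" using dvd by (metis dvd_add_right_iff dvd_triv_left)
    then have r6: "r mod 6 = 5" by presburger
    \<comment> \<open>A negative \<open>r\<close> would give pr + s = (p - 1) r + 4 \<le> 5 - p,
      which is negative because p \<ge> 29. For p = 5 this bound is 0, which is why 5 is
      exceptional.\<close>
    have "r \<ge> 0"
    proof (rule ccontr)
      assume "\<not> r \<ge> 0"
      then have "r \<le> -1" by simp
      then have "(int p - 1) * r \<le> (int p - 1) * (-1)" using p by (intro mult_left_mono) auto
      then show False using nonneg(2) t t1 unfolding s by (simp add: algebra_simps)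
    qed
    moreover have "s \<ge> 0"
    proof (rule ccontr)
      assume "\<not> s \<ge> 0"
      then have "s \<le> -1" by simp
      then have "(int p - 1) * s \<le> (int p - 1) * (-1)" using p by (intro mult_left_mono) auto
      then show False using nonneg(1) t t1 s by (simp add: algebra_simps)
    qed
    ultimately show False using r6 s by presburger
  qed
qed

lemma prime_mod_24:
  fixes p :: nat
  assumes "prime p" "p \<ge> 5"
  shows "p mod 24 \<in> {1, 5, 7, 11, 13, 17, 19, 23}"
proof -
  have "odd p" using assms prime_odd_nat by force
  moreover have "\<not> 3 dvd p" using assms primes_dvd_imp_eq[of 3 p] by auto
  ultimately have "p mod 24 = 1 \<or> p mod 24 = 5 \<or> p mod 24 = 7 \<or> p mod 24 = 11 \<or>
     p mod 24 = 13 \<or> p mod 24 = 17 \<or> p mod 24 = 19 \<or> p mod 24 = 23" by presburger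
  then show ?thesis by simp
qed

text \<open>Exponents are given explicitly for each residue \<rho> of \<open>p\<close> modulo 24.
  Apart from p = 5, k = 2, both can be taken nonnegative, which settles the orders and leaves only a
  congruence.\<close>

lemma conditions_imp_eta_exponents:
  fixes p h :: nat and k :: int
  assumes p: "prime p" "p \<ge> 5" and h: "h = gcd (p - 1) 24 div 2"
    and k: "even k" "k \<ge> 0"
    and dvd: "int h dvd k" and excl: "\<not> (p \<noteq> 5 \<and> [p = 5] (mod 24) \<and> k = 2)"
  shows "\<exists>r s :: int. r + s = 2 * k \<and> 24 dvd int p * r + s \<and> r + int p * s \<ge> 0 \<and> int p * r + s \<ge> 0"
proof -
  define t where "t = p div 24"
  define \<rho> where "\<rho> = p mod 24"
  have pt: "p = 24 * t + \<rho>" by (simp add: t_def \<rho>_def)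
  have \<rho>: "\<rho> \<in> {1, 5, 7, 11, 13, 17, 19, 23}" unfolding \<rho>_def by (rule prime_mod_24[OF p])
  \<comment> \<open>The value of \<open>h\<close> depends only on the residue \<rho>.\<close>
  have "p - 1 = 24 * t + (\<rho> - 1)" using \<rho> pt by auto
  then have "gcd (p - 1) 24 = gcd (\<rho> - 1) 24"
    by (metis gcd.commute gcd_add_mult mult.commute add.commute)
  then have h': "h = gcd (\<rho> - 1) 24 div 2" using h by simp
  have nonneg: ?thesis if "r \<ge> 0" "s \<ge> 0" "r + s = 2 * k" "24 dvd int \<rho> * r + s" for r s :: int
  proof -
    have "int p * r + s = 24 * (int t * r) + (int \<rho> * r + s)" unfolding pt by (simp add: algebra_simps)
    then have "24 dvd int p * r + s" using that(4) by (metis dvd_add dvd_triv_left)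
    then show ?thesis using that by (intro exI[of _ r] exI[of _ s]) auto
  qed
  obtain k' where k': "k = 2 * k'" using k by blast
  consider "\<rho> = 1" | "\<rho> = 5" | "\<rho> = 7 \<or> \<rho> = 19" | "\<rho> = 11 \<or> \<rho> = 23" | "\<rho> = 13" | "\<rho> = 17"
    using \<rho> by auto
  then show ?thesis
  proof cases
    case 1
    then have "h = 12" using h' by simp
    then obtain m where "k = 12 * m" using dvd by auto
    then show ?thesis using k 1 by (intro nonneg[of "2 * k" 0]) auto
  next
    case 2
    show ?thesis
    proof (cases "k = 2")
      case True
      then have "p = 5" using excl 2 by (auto simp: \<rho>_def cong_def)
      \<comment> \<open>The weight 2 form eta(5 \<tau>)^5 / eta(\<tau>), whose order at the cusp 0
        is exactly 0.\<close>
      then show ?thesis using True by (intro exI[of _ "-1"] exI[of _ 5]) simp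
    next
      case False
      \<comment> \<open>With r = 2k - s and k = 2k', the number 5r + s is 4(5k' - s), so
        \<open>s\<close> has to be -k' modulo 6. Its least residue is at most 2k except for k = 2,
        where it is 5.\<close>
      define s where "s = (- k') mod 6"
      have s: "0 \<le> s" "s < 6" by (simp_all add: s_def)
      have "s \<le> 2 * k"
      proof (cases "k = 0")
        case True
        then show ?thesis using k' by (simp add: s_def)
      next
        case False
        with \<open>k \<noteq> 2\<close> k k' have "k \<ge> 4" by presburger
        then show ?thesis using s by simp
      qed
      moreover have "24 dvd 5 * (2 * k - s) + s"
        unfolding k' s_def by presburger
      ultimately show ?thesis using s 2 by (intro nonneg[of "2 * k - s" s]) auto
    qed
  next
    case 3
    have "gcd 6 24 = (6::nat)" "gcd 18 24 = (6::nat)" by (simp_all add: gcd_nat.simps)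
    then have "h = 3" using h' 3 by auto
    then have "3 dvd k" using dvd by simp
    then have "6 dvd k" using k by presburger
    then obtain m where "k = 6 * m" by blast
    \<comment> \<open>Both 7 * 10 + 2 = 72 and 19 * 10 + 2 = 192 are multiples of 24.\<close>
    then show ?thesis using k 3 by (intro nonneg[of "10 * m" "2 * m"]) auto
  next
    case 4
    \<comment> \<open>Here 12 divides \<rho> + 1 and \<open>k\<close> is even, so equal exponents
      work.\<close>
    then show ?thesis using k k' by (intro nonneg[of k k]) auto
  next
    case 5
    have "gcd 12 24 = (12::nat)" by (simp add: gcd_nat.simps)
    then have "h = 6" using h' 5 by auto
    then obtain m where "k = 6 * m" using dvd by auto
    \<comment> \<open>The ratio 11 : 1 works because 13 * 11 + 1 = 144.\<close>
    then show ?thesis using k 5 by (intro nonneg[of "11 * m" m]) auto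
  next
    case 6
    have "gcd 16 24 = (8::nat)" by (simp add: gcd_nat.simps)
    then have "h = 4" using h' 6 by auto
    then obtain m where "k = 4 * m" using dvd by auto
    then show ?thesis using k 6 by (intro nonneg[of k k]) auto
  qed
qed

text \<open>Adding the two order conditions gives 2(p + 1)k \<ge> 0, so no such eta quotient has
  negative weight, although \<open>h\<close> can divide a negative \<open>k\<close>; hence the
  assumption \<open>k \<ge> 0\<close>.\<close>

theorem theorem1p9:
  fixes p h :: nat and k :: int
  assumes "prime p" and "p \<ge> 5"
    and "h = gcd (p - 1) 24 div 2"
    and "even k" and "k \<ge> 0"
  shows "(\<exists>r\<^sub>1 r\<^sub>p :: int.
            (\<lambda>\<tau>. dedekind_eta \<tau> powi r\<^sub>1 * dedekind_eta (of_nat p * \<tau>) powi r\<^sub>p)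
              \<in> modular_forms_Gamma1 k p) \<longleftrightarrow>
         int h dvd k \<and> \<not> (p \<noteq> 5 \<and> [p = 5] (mod 24) \<and> k = 2)"
proof -
  have "odd p" "p > 1" using assms prime_odd_nat by force+
  moreover have "(\<lambda>\<tau>. dedekind_eta \<tau> powi r * dedekind_eta (of_nat p * \<tau>) powi s) = eta_quotient p r s" for r s
    by (simp add: fun_eq_iff eta_quotient_def)
  ultimately show ?thesis
    using eta_exponents_imp_conditions[OF _ _ assms(3)] conditions_imp_eta_exponents[OF assms]
    by (simp only: eta_quotient_modular_iff[OF assms(1,2)]) blast
qed

end
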